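(* Let $q_1,q_2$ be primitive indefinite binary quadratic forms (PIBQFs) of discriminants $D_1,D_2$. Then the unweighted intersection number $\mathrm{Int}(q_1,q_2)$ is equal to the size of the set $$\left\{(q_1',q_2'): q_1'\sim q_1,\ q_2'\sim q_2,\ |\ell_{q_1'}\pitchfork \ell_{q_2'}|=1\right\}/\sim_2 .$$ Furthermore, for all $q_1'\sim q_1$ and $q_2'\sim q_2$, $$|\ell_{q_1'}\pitchfork \ell_{q_2'}|=1\iff |B_\Delta(q_1',q_2')|<\sqrt{D_1D_2}.$$
   Context: Write $[A,B,C]$ for the form $Ax^2+Bxy+Cy^2$ with integer coefficients; its discriminant is $D=B^2-4AC$. A PIBQF is such a form with $\gcd(A,B,C)=1$ and $D>0$ not a perfect square. $\Gamma=\mathrm{PSL}(2,\mathbb Z)$ acts (on the right) on forms by $(\gamma\circ q)(x,y)=q(ax+by,cx+dy)$ for $\gamma=\begin{pmatrix}a&b\\c&d\end{pmatrix}$. Write $q\sim q'$ if $q'=\gamma\circ q$ for some $\gamma\in\Gamma$, and $(q_1,q_2)\sim_2(q_1',q_2')$ if there is a single $\gamma\in\Gamma$ with $\gamma\circ q_i=q_i'$ for $i=1,2$. For $q=[A,B,C]$ the first root is $q_f=\frac{-B+\sqrt D}{2A}$ and the second root is $q_s=\frac{-B-\sqrt D}{2A}$. The root geodesic $\ell_q$ is the oriented hyperbolic geodesic in the upper half plane $\mathbb H$ running from $q_s$ to $q_f$. The invariant automorph of $q$ is $\gamma_q=\begin{pmatrix}\frac{T-BU}{2} & -CU \\ A U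 & \frac{T+BU}{2}\end{pmatrix}$, where $(T,U)$ is the smallest positive integer solution of $t^2-Du^2=4$; it generates the stabilizer of $q$ in $\Gamma$ and preserves $\ell_q$. Hence $\ell_q$ projects to a closed geodesic $\tilde\ell_q$ in $\Gamma\backslash\mathbb H$, depending only on the class of $q$. $|\ell\pitchfork\ell'|$ denotes the number of transverse intersection points in $\mathbb H$ of the geodesics (or geodesic segments) $\ell,\ell'$. The unweighted intersection number $\mathrm{Int}(q_1,q_2)$ is the number of transverse intersections of $\tilde\ell_{q_1}$ with $\tilde\ell_{q_2}$ (unsigned). These are counted as follows: fix any $z\in\ell_{q_2}$ and let $\dot\ell$ be the half-open segment of $\ell_{q_2}$ from $z$ (included) to $\gamma_{q_2}z$ (excluded); each transverse intersection lifts to a unique pair $(\ell,P)$, where $\ell$ is an oriented geodesic that is a $\Gamma$-translate of $\ell_{q_1}$ and $P$ is a transverse intersection point of $\ell$ with $\dot\ell$, and $\mathrm{Int}(q_1,q_2)$ is the number of such pairs (it does not depend on $z$). Finally, $B_\Delta([A_1,B_1,C_1],[A_2,B_2,C_2]):=B_1B_2-2A_1C_2-2A_2C_1$. *)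

theory Defs
  imports "HOL-Analysis.Analysis"
begin

text \<open>The triple \<open>(A, B, C)\<close> stands for the form \<open>[A, B, C] = A x^2 + B x y + C y^2\<close>.\<close>

type_synonym bqf = "int \<times> int \<times> int"

fun eval_bqf :: "bqf \<Rightarrow> int \<Rightarrow> int \<Rightarrow> int" where
  "eval_bqf (A, B, C) x y = A * x^2 + B * x * y + C * y^2"

fun disc :: "bqf \<Rightarrow> int" where
  "disc (A, B, C) = B^2 - 4 * A * C"

fun PIBQF :: "bqf \<Rightarrow> bool" where
  "PIBQF (A, B, C) \<longleftrightarrow>
     gcd A (gcd B C) = 1 \<and> disc (A, B, C) > 0 \<and> (\<nexists>k. disc (A, B, C) = k^2)"

fun B_Delta :: "bqf \<Rightarrow> bqf \<Rightarrow> int" where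
  "B_Delta (A\<^sub>1, B\<^sub>1, C\<^sub>1) (A\<^sub>2, B\<^sub>2, C\<^sub>2) = B\<^sub>1 * B\<^sub>2 - 2 * A\<^sub>1 * C\<^sub>2 - 2 * A\<^sub>2 * C\<^sub>1"

text \<open>Elements of \<open>PSL(2, \<int>)\<close> are given by representatives in \<open>SL(2, \<int>)\<close>. Below, matrices only
  occur under an existential quantifier and through their actions on forms and points, on which a
  matrix and its negative agree.\<close>

definition SL2Z :: "(int^2^2) set" where
  "SL2Z = {\<gamma>. det \<gamma> = 1}"

fun act_bqf :: "int^2^2 \<Rightarrow> bqf \<Rightarrow> bqf" where
  "act_bqf \<gamma> (A, B, C) =
    (let a = \<gamma>$1$1; b = \<gamma>$1$2; c = \<gamma>$2$1; d = \<gamma>$2$2 in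
      (A * a^2 + B * a * c + C * c^2,
       2 * A * a * b + B * (a * d + b * c) + 2 * C * c * d,
       A * b^2 + B * b * d + C * d^2))"

lemma eval_act_bqf:
  "eval_bqf (act_bqf \<gamma> q) x y = eval_bqf q (\<gamma>$1$1 * x + \<gamma>$1$2 * y) (\<gamma>$2$1 * x + \<gamma>$2$2 * y)"
  by (cases q) (simp add: Let_def power2_eq_square algebra_simps)

definition bqf_equiv :: "bqf \<Rightarrow> bqf \<Rightarrow> bool" where
  "bqf_equiv q q' \<longleftrightarrow> (\<exists>\<gamma>\<in>SL2Z. q' = act_bqf \<gamma> q)"

definition simultaneous_equiv :: "((bqf \<times> bqf) \<times> (bqf \<times> bqf)) set" where
  "simultaneous_equiv =
    {((q\<^sub>1, q\<^sub>2), (q\<^sub>1', q\<^sub>2')). \<exists>\<gamma>\<in>SL2Z. act_bqf \<gamma> q\<^sub>1 = q\<^sub>1' \<and> act_bqf \<gamma> q\<^sub>2 = q\<^sub>2'}"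

definition moebius :: "int^2^2 \<Rightarrow> 'a::field \<Rightarrow> 'a" where
  "moebius \<gamma> z = (of_int (\<gamma>$1$1) * z + of_int (\<gamma>$1$2)) / (of_int (\<gamma>$2$1) * z + of_int (\<gamma>$2$2))"

text \<open>An oriented geodesic of the upper half plane with distinct real endpoints is encoded by the
  pair \<open>(s, f)\<close> of its initial and final endpoint. The endpoint \<open>\<infinity>\<close> is not needed: root geodesics
  of PIBQFs have irrational endpoints, and so do their translates under integral matrices.\<close>

type_synonym geodesic = "real \<times> real"

text \<open>The unit speed parametrisation in the hyperbolic metric.\<close>

fun geodesic_path :: "geodesic \<Rightarrow> real \<Rightarrow> complex" where
  "geodesic_path (s, f) t = Complex ((s + f) / 2 + (f - s) / 2 * tanh t) (\<bar>f - s\<bar> / (2 * cosh t))"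

lemma geodesic_path_endpoints:
  assumes "s \<noteq> f"
  shows "(geodesic_path (s, f) \<longlongrightarrow> of_real s) at_bot"
    and "(geodesic_path (s, f) \<longlongrightarrow> of_real f) at_top"
proof -
  have "((\<lambda>t. \<bar>f - s\<bar> / (2 * cosh t)) \<longlongrightarrow> 0) at_top" "((\<lambda>t. \<bar>f - s\<bar> / (2 * cosh t)) \<longlongrightarrow> 0) at_bot"
    by (rule real_tendsto_divide_at_top tendsto_const filterlim_tendsto_pos_mult_at_top
          cosh_real_at_top cosh_real_at_bot zero_less_numeral)+
  moreover have "((\<lambda>t. (s + f) / 2 + (f - s) / 2 * tanh t) \<longlongrightarrow> (s + f) / 2 + (f - s) / 2 * 1) at_top"
    "((\<lambda>t. (s + f) / 2 + (f - s) / 2 * tanh t) \<longlongrightarrow> (s + f) / 2 + (f - s) / 2 * (- 1)) at_bot"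
    by (intro tendsto_intros tanh_real_at_top tanh_real_at_bot)+
  ultimately show "(geodesic_path (s, f) \<longlongrightarrow> of_real s) at_bot"
    and "(geodesic_path (s, f) \<longlongrightarrow> of_real f) at_top"
    by (auto simp: tendsto_complex_iff field_simps)
qed

definition geodesic_points :: "geodesic \<Rightarrow> complex set" where
  "geodesic_points g = range (geodesic_path g)"

lemma tanh_cosh_square: "tanh t ^ 2 + 1 / cosh t ^ 2 = (1::real)"
proof -
  have "tanh t ^ 2 + 1 / cosh t ^ 2 = (sinh t ^ 2 + 1) / cosh t ^ 2"
    by (simp add: tanh_def power_divide add_divide_distrib)
  thus ?thesis by (simp flip: cosh_square_eq)
qed

lemma geodesic_points_eq:
  assumes "s \<noteq> f"
  shows "geodesic_points (s, f) =
    {z. Im z > 0 \<and> cmod (z - of_real ((s + f) / 2)) = \<bar>f - s\<bar> / 2}"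
proof (intro equalityI subsetI)
  fix z assume "z \<in> geodesic_points (s, f)"
  then obtain t where z: "z = geodesic_path (s, f) t" by (auto simp: geodesic_points_def)
  have "cmod (z - of_real ((s + f) / 2)) ^ 2 = ((f - s) / 2)^2 * (tanh t ^ 2 + 1 / cosh t ^ 2)"
    unfolding z cmod_power2 by (simp add: power_mult_distrib power_divide distrib_left)
  hence "cmod (z - of_real ((s + f) / 2)) ^ 2 = (\<bar>f - s\<bar> / 2)^2"
    by (simp add: tanh_cosh_square power_divide)
  thus "z \<in> {z. Im z > 0 \<and> cmod (z - of_real ((s + f) / 2)) = \<bar>f - s\<bar> / 2}"
    using assms by (simp add: z power2_eq_iff_nonneg)
next
  fix z assume "z \<in> {z. Im z > 0 \<and> cmod (z - of_real ((s + f) / 2)) = \<bar>f - s\<bar> / 2}"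
  hence im: "Im z > 0" and c: "cmod (z - of_real ((s + f) / 2)) = \<bar>f - s\<bar> / 2" by auto
  define x where "x = (Re z - (s + f) / 2) / ((f - s) / 2)"
  have fs: "f - s \<noteq> 0" using assms by simp
  have "(f - s) / 2 * x = Re z - (s + f) / 2"
    unfolding x_def times_divide_eq_right[of "(f - s) / 2" _ "(f - s) / 2"]
    by (rule nonzero_mult_div_cancel_left) (use fs in simp)
  hence rz: "Re z = (s + f) / 2 + (f - s) / 2 * x" by linarith
  have "(Re z - (s + f) / 2)^2 + (Im z)^2 = ((f - s) / 2)^2"
    using arg_cong[OF c, of "\<lambda>x. x^2"] by (simp add: cmod_power2 power_divide)
  hence i2: "(Im z)^2 = ((f - s) / 2)^2 * (1 - x^2)"
    by (simp add: rz power_mult_distrib power_divide right_diff_distrib)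
  have "x^2 < 1"
  proof -
    have "((f - s) / 2)^2 * (1 - x^2) > 0" unfolding i2[symmetric] using im by simp
    hence "1 - x^2 > 0" by (rule zero_less_mult_pos) (use fs in simp)
    thus ?thesis by simp
  qed
  hence x: "\<bar>x\<bar> < 1" by (simp add: abs_square_less_1)
  define t where "t = - ln ((1 - x) / (1 + x)) / 2"
  have pos: "1 - x > 0" "1 + x > 0" using x by linarith+
  hence x': "1 + x \<noteq> 0" by linarith
  have "exp (- 2 * t) = exp (ln ((1 - x) / (1 + x)))" unfolding t_def by simp
  also have "\<dots> = (1 - x) / (1 + x)" by (rule exp_ln) (rule divide_pos_pos[OF pos])
  finally have e: "exp (- 2 * t) = (1 - x) / (1 + x)" .
  have "1 - (1 - x) / (1 + x) = 2 * x / (1 + x)" "1 + (1 - x) / (1 + x) = 2 / (1 + x)"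
    using x' by (simp_all add: field_simps)
  hence "tanh t = (2 * x / (1 + x)) / (2 / (1 + x))"
    unfolding tanh_real_altdef e by (rule arg_cong2[where f = "(/)"])
  hence t: "tanh t = x" using x' by simp
  have h: "(\<bar>f - s\<bar> / (2 * cosh t))^2 = ((f - s) / 2)^2 * (1 - x^2)"
  proof -
    have "1 - x^2 = 1 / cosh t ^ 2" using tanh_cosh_square[of t] by (simp add: t)
    thus ?thesis by (simp add: power_divide power_mult_distrib)
  qed
  have "0 \<le> \<bar>f - s\<bar> / (2 * cosh t)" by simp
  hence "Im z = \<bar>f - s\<bar> / (2 * cosh t)"
    by (rule power2_eq_imp_eq[OF trans[OF i2 h[symmetric]] less_imp_le[OF im]])
  hence "z = geodesic_path (s, f) t" by (simp add: complex_eq_iff rz t)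
  thus "z \<in> geodesic_points (s, f)" by (auto simp: geodesic_points_def)
qed

definition translate_geodesic :: "int^2^2 \<Rightarrow> geodesic \<Rightarrow> geodesic" where
  "translate_geodesic \<gamma> g = (moebius \<gamma> (fst g), moebius \<gamma> (snd g))"

definition transverse_points :: "geodesic \<Rightarrow> geodesic \<Rightarrow> complex set" where
  "transverse_points g h =
    {P. \<exists>t u. geodesic_path g t = P \<and> geodesic_path h u = P \<and>
        \<not> collinear {0, vector_derivative (geodesic_path g) (at t),
                        vector_derivative (geodesic_path h) (at u)}}"

definition half_open_segment :: "geodesic \<Rightarrow> complex \<Rightarrow> complex \<Rightarrow> complex set" where
  "half_open_segment g z w =
    {geodesic_path g t | t t\<^sub>0 t\<^sub>1. geodesic_path g t\<^sub>0 = z \<and> geodesic_path g t\<^sub>1 = w \<and>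
        t \<in> closed_segment t\<^sub>0 t\<^sub>1 \<and> t \<noteq> t\<^sub>1}"

fun first_root :: "bqf \<Rightarrow> real" where
  "first_root (A, B, C) = (- of_int B + sqrt (of_int (disc (A, B, C)))) / (2 * of_int A)"

fun second_root :: "bqf \<Rightarrow> real" where
  "second_root (A, B, C) = (- of_int B - sqrt (of_int (disc (A, B, C)))) / (2 * of_int A)"

definition root_geodesic :: "bqf \<Rightarrow> geodesic" where
  "root_geodesic q = (second_root q, first_root q)"

definition pell4 :: "int \<Rightarrow> int \<Rightarrow> int \<Rightarrow> bool" where
  "pell4 D t u \<longleftrightarrow> t > 0 \<and> u > 0 \<and> t^2 - D * u^2 = 4"

text \<open>For \<open>D > 0\<close> the coordinates of positive solutions increase together, so the smallest solution
  is the one minimising both.\<close>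

definition smallest_pell4 :: "int \<Rightarrow> int \<times> int" where
  "smallest_pell4 D = (THE (T, U). pell4 D T U \<and> (\<forall>t u. pell4 D t u \<longrightarrow> T \<le> t \<and> U \<le> u))"

text \<open>The halves are exact, as \<open>T\<close> and \<open>B * U\<close> have the same parity.\<close>

fun automorph :: "bqf \<Rightarrow> int^2^2" where
  "automorph (A, B, C) =
    (let (T, U) = smallest_pell4 (disc (A, B, C)) in
      vector [vector [(T - B * U) div 2, - C * U],
              vector [A * U, (T + B * U) div 2]])"

definition lifted_intersections :: "bqf \<Rightarrow> bqf \<Rightarrow> complex \<Rightarrow> (geodesic \<times> complex) set" where
  "lifted_intersections q\<^sub>1 q\<^sub>2 z =
    {(g, P). g \<in> (\<lambda>\<gamma>. translate_geodesic \<gamma> (root_geodesic q\<^sub>1)) ` SL2Z \<and>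
       P \<in> transverse_points g (root_geodesic q\<^sub>2) \<and>
       P \<in> half_open_segment (root_geodesic q\<^sub>2) z (moebius (automorph q\<^sub>2) z)}"

text \<open>The intersection number, computed from a base point \<open>z\<close> on the root geodesic of \<open>q\<^sub>2\<close>.\<close>

definition intersection_number :: "bqf \<Rightarrow> bqf \<Rightarrow> complex \<Rightarrow> nat" where
  "intersection_number q\<^sub>1 q\<^sub>2 z = card (lifted_intersections q\<^sub>1 q\<^sub>2 z)"

definition intersecting_pairs :: "bqf \<Rightarrow> bqf \<Rightarrow> (bqf \<times> bqf) set" where
  "intersecting_pairs q\<^sub>1 q\<^sub>2 =
    {(q\<^sub>1', q\<^sub>2'). bqf_equiv q\<^sub>1 q\<^sub>1' \<and> bqf_equiv q\<^sub>2 q\<^sub>2' \<and>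
       card (transverse_points (root_geodesic q\<^sub>1') (root_geodesic q\<^sub>2')) = 1}"

end

theory Submission
  imports Defs
begin

text \<open>The translates of the root geodesic of \<open>q\<^sub>1\<close> are the root geodesics of the forms \<open>p\<close>
  equivalent to \<open>q\<^sub>1\<close>, and every class of intersecting pairs contains pairs \<open>(p, q\<^sub>2)\<close>, determined up
  to the stabilizer of \<open>q\<^sub>2\<close>. The stabilizer acts on the root geodesic of \<open>q\<^sub>2\<close> by translations, and
  minimality of the Pell solution makes the translation length of the automorph the smallest positive
  one. Hence every class contains exactly one pair whose intersection point lies on the half-open
  segment.\<close>

section \<open>Forms and the modular group\<close>

text \<open>The root geodesic of \<open>act_bqf \<gamma> q\<close> is the translate by \<gamma>^-1
  of that of \<open>q\<close>, so transport always runs from the former to the latter by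
  \<open>moebius \<gamma>\<close>. Whether two geodesics cross has to be carried along equivalences
  of pairs. This is done algebraically: \<open>disc\<close> and \<open>B_Delta\<close> are
  invariants, so the criterion by \<open>B_Delta\<close> moves along for free and no tangent vector
  is pushed through a Moebius map. The automorph is given only by a Pell solution. In place of the
  fact that it generates the stabilizer, it is shown that a stabilizer element moving points by less
  than the length of the automorph is 1 or -1. An element with (c, d - a, -b) = u (A, B, C) and
  trace t satisfies t^2 - D u^2 = 4 and translates by 2 ln |(t + u sqrt D) / 2|, so a shorter one
  with u nonzero contradicts minimality. Primitivity makes u an integer. As \<open>card\<close> is 0
  on infinite sets, finiteness is a claim of its own. It comes from (2 A x + B)^2 + (2 A y)^2 = D on
  the geodesic, which leaves finitely many forms near a compact segment.\<close>

definition indefinite :: "bqf \<Rightarrow> bool" where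
  "indefinite q \<longleftrightarrow> disc q > 0 \<and> (\<nexists>k. disc q = k^2)"

lemma PIBQF_indefinite: "PIBQF q \<Longrightarrow> indefinite q"
  by (cases q) (auto simp: indefinite_def)

lemma indefinite_fst_nonzero: "indefinite (A, B, C) \<Longrightarrow> A \<noteq> 0"
  by (auto simp: indefinite_def)

text \<open>The adjugate: it stays integral and inverts the matrices of determinant 1.\<close>

definition sl2_inv :: "int^2^2 \<Rightarrow> int^2^2" where
  "sl2_inv \<gamma> = vector [vector [\<gamma>$2$2, - \<gamma>$1$2], vector [- \<gamma>$2$1, \<gamma>$1$1]]"

lemma sl2_inv_nth [simp]:
  "sl2_inv \<gamma> $ 1 $ 1 = \<gamma>$2$2" "sl2_inv \<gamma> $ 1 $ 2 = - \<gamma>$1$2"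
  "sl2_inv \<gamma> $ 2 $ 1 = - \<gamma>$2$1" "sl2_inv \<gamma> $ 2 $ 2 = \<gamma>$1$1"
  by (simp_all add: sl2_inv_def)

lemma SL2Z_iff: "\<gamma> \<in> SL2Z \<longleftrightarrow> \<gamma>$1$1 * \<gamma>$2$2 - \<gamma>$1$2 * \<gamma>$2$1 = 1"
  by (simp add: SL2Z_def det_2)

lemma sl2_inv_SL2Z [simp]: "\<gamma> \<in> SL2Z \<Longrightarrow> sl2_inv \<gamma> \<in> SL2Z"
  by (simp add: SL2Z_iff algebra_simps)

lemma sl2_inv_inv [simp]: "sl2_inv (sl2_inv \<gamma>) = \<gamma>"
  by (simp add: vec_eq_iff forall_2)

lemma matrix_mult_2_nth:
  fixes \<gamma> \<delta> :: "int^2^2"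
  shows "(\<gamma> ** \<delta>) $ i $ j = \<gamma>$i$1 * \<delta>$1$j + \<gamma>$i$2 * \<delta>$2$j"
  by (simp add: matrix_matrix_mult_def sum_2)

lemma SL2Z_mult [simp]: "\<gamma> \<in> SL2Z \<Longrightarrow> \<delta> \<in> SL2Z \<Longrightarrow> \<gamma> ** \<delta> \<in> SL2Z"
  by (simp add: SL2Z_def det_mul)

lemma SL2Z_one [simp]: "mat 1 \<in> SL2Z"
  by (simp add: SL2Z_def)

lemma act_bqf_mult: "act_bqf (\<gamma> ** \<delta>) q = act_bqf \<delta> (act_bqf \<gamma> q)"
  by (cases q) (simp add: Let_def matrix_mult_2_nth power2_eq_square algebra_simps)

lemma act_bqf_one [simp]: "act_bqf (mat 1) q = q"
  by (cases q) (simp add: Let_def mat_def)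

lemma sl2_inv_mult: "\<gamma> \<in> SL2Z \<Longrightarrow> \<gamma> ** sl2_inv \<gamma> = mat 1" "\<gamma> \<in> SL2Z \<Longrightarrow> sl2_inv \<gamma> ** \<gamma> = mat 1"
  by (simp_all add: vec_eq_iff forall_2 matrix_mult_2_nth mat_def SL2Z_iff algebra_simps)

lemma act_bqf_inv [simp]:
  assumes "\<gamma> \<in> SL2Z"
  shows "act_bqf (sl2_inv \<gamma>) (act_bqf \<gamma> q) = q" "act_bqf \<gamma> (act_bqf (sl2_inv \<gamma>) q) = q"
  using assms by (simp_all flip: act_bqf_mult add: sl2_inv_mult)

lemma disc_act_bqf:
  assumes "\<gamma> \<in> SL2Z"
  shows "disc (act_bqf \<gamma> q) = disc q"
proof -
  obtain A B C where q: "q = (A, B, C)" by (cases q)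
  have "disc (act_bqf \<gamma> q) = (\<gamma>$1$1 * \<gamma>$2$2 - \<gamma>$1$2 * \<gamma>$2$1)^2 * disc q"
    by (simp add: q Let_def power2_eq_square algebra_simps)
  thus ?thesis using assms by (simp add: SL2Z_iff)
qed

text \<open>\<open>B_Delta\<close> is the symmetric bilinear form that polarizes
  \<open>disc\<close>, so it scales by the square of the determinant in the same way.\<close>

lemma B_Delta_act_bqf:
  assumes "\<gamma> \<in> SL2Z"
  shows "B_Delta (act_bqf \<gamma> q) (act_bqf \<gamma> q') = B_Delta q q'"
proof -
  obtain A B C where q: "q = (A, B, C)" by (cases q)
  obtain A' B' C' where q': "q' = (A', B', C')" by (cases q')
  have "B_Delta (act_bqf \<gamma> q) (act_bqf \<gamma> q') = (\<gamma>$1$1 * \<gamma>$2$2 - \<gamma>$1$2 * \<gamma>$2$1)^2 * B_Delta q q'"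
    by (simp add: q q' Let_def power2_eq_square algebra_simps)
  thus ?thesis using assms by (simp add: SL2Z_iff)
qed

lemma indefinite_act_bqf [simp]: "\<gamma> \<in> SL2Z \<Longrightarrow> indefinite (act_bqf \<gamma> q) \<longleftrightarrow> indefinite q"
  by (simp add: indefinite_def disc_act_bqf)

lemma bqf_equivE:
  assumes "bqf_equiv q q'"
  obtains \<gamma> where "\<gamma> \<in> SL2Z" "q' = act_bqf \<gamma> q"
  using assms by (auto simp: bqf_equiv_def)

lemma bqf_equiv_act_bqf: "bqf_equiv q q' \<Longrightarrow> \<gamma> \<in> SL2Z \<Longrightarrow> bqf_equiv q (act_bqf \<gamma> q')"
  unfolding bqf_equiv_def by (metis act_bqf_mult SL2Z_mult)

lemma bqf_equiv_refl: "bqf_equiv q q"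
  unfolding bqf_equiv_def by (metis act_bqf_one SL2Z_one)

lemma bqf_equiv_disc: "bqf_equiv q q' \<Longrightarrow> disc q' = disc q"
  by (auto simp: bqf_equiv_def disc_act_bqf)

lemma bqf_equiv_indefinite: "bqf_equiv q q' \<Longrightarrow> indefinite q \<Longrightarrow> indefinite q'"
  by (simp add: indefinite_def bqf_equiv_disc)

lemma simultaneous_equiv_iff:
  "((p, q), (p', q')) \<in> simultaneous_equiv \<longleftrightarrow>
    (\<exists>\<gamma>\<in>SL2Z. act_bqf \<gamma> p = p' \<and> act_bqf \<gamma> q = q')"
  by (simp add: simultaneous_equiv_def del: act_bqf.simps)

lemma equiv_simultaneous_equiv: "equiv UNIV simultaneous_equiv"
proof -
  have *: "(P, Q) \<in> simultaneous_equiv \<longleftrightarrow>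
      (\<exists>\<gamma>\<in>SL2Z. act_bqf \<gamma> (fst P) = fst Q \<and> act_bqf \<gamma> (snd P) = snd Q)" for P Q
    using simultaneous_equiv_iff[of "fst P" "snd P" "fst Q" "snd Q"]
    unfolding prod.collapse .
  show ?thesis
  proof (rule equivI)
    show "refl simultaneous_equiv"
      unfolding refl_on_def * by (metis act_bqf_one SL2Z_one UNIV_I)
    show "sym simultaneous_equiv"
      unfolding sym_def * by (metis act_bqf_inv(1) sl2_inv_SL2Z)
    show "trans simultaneous_equiv"
      unfolding trans_def * by (metis act_bqf_mult SL2Z_mult)
  qed auto
qed

text \<open>A matrix \<open>\<gamma>\<close> fixing a form with Gram matrix \<open>M\<close> satisfies \<open>M \<gamma> = \<gamma>\<^sup>-\<^sup>T M\<close>, which says that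
  \<open>(c, d - a, - b)\<close> is proportional to \<open>(A, B, C)\<close>.\<close>

lemma stabilizer_form:
  assumes "\<gamma> \<in> SL2Z" and stab: "act_bqf \<gamma> (A, B, C) = (A, B, C)"
    and "A \<noteq> 0" and prim: "gcd A (gcd B C) = 1"
  obtains u where "\<gamma>$2$1 = A * u" "\<gamma>$2$2 - \<gamma>$1$1 = B * u" "\<gamma>$1$2 = - C * u"
proof -
  define a b c d where abcd: "a = \<gamma>$1$1" "b = \<gamma>$1$2" "c = \<gamma>$2$1" "d = \<gamma>$2$2"
  have det: "a * d - b * c = 1" using assms(1) by (simp add: SL2Z_iff abcd)
  have e: "A * a^2 + B * a * c + C * c^2 = A"
    "2 * A * a * b + B * (a * d + b * c) + 2 * C * c * d = B"
    using stab by (simp_all add: Let_def abcd)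
  \<comment> \<open>With determinant 1 this is entry (2,1) of M \<gamma> = \<gamma>^-T M; the
    computation leading to \<open>2\<close> is entry (1,1).\<close>
  have "(B * a + 2 * C * c) * (a * d - b * c)
      = a * (2 * A * a * b + B * (a * d + b * c) + 2 * C * c * d)
        - 2 * b * (A * a^2 + B * a * c + C * c^2)"
    by (simp add: algebra_simps power2_eq_square)
  hence "B * a + 2 * C * c = a * B - 2 * b * A" unfolding e det by simp
  hence 1: "A * b = - (c * C)" by algebra
  have "(2 * A * a + B * c) * (a * d - b * c)
      = 2 * d * (A * a^2 + B * a * c + C * c^2)
        - c * (2 * A * a * b + B * (a * d + b * c) + 2 * C * c * d)"
    by (simp add: algebra_simps power2_eq_square)
  hence "2 * A * a + B * c = 2 * d * A - c * B" unfolding e det by simp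
  hence 2: "A * (d - a) = c * B" by algebra
  \<comment> \<open>A divides c gcd(B, C) and is coprime to gcd(B, C) by primitivity, so the
    rational factor c / A is an integer.\<close>
  have "A dvd c * B" "A dvd c * C"
    by (metis 2 dvd_triv_left) (metis 1 dvd_minus_iff dvd_triv_left)
  hence "A dvd gcd (c * B) (c * C)" by simp
  hence "A dvd c * gcd B C" by (simp add: gcd_mult_left)
  hence "A dvd c" using prim by (simp add: coprime_dvd_mult_left_iff coprime_iff_gcd_eq_1)
  then obtain u where u: "c = A * u" ..
  have "A * (d - a) = A * (B * u)" using 2 u by (simp add: mult_ac)
  moreover have "A * b = A * (- C * u)" using 1 u by simp
  ultimately have "d - a = B * u" "b = - C * u" using \<open>A \<noteq> 0\<close> mult_left_cancel by blast+
  thus ?thesis using that[of u] u by (simp add: abcd)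
qed

section \<open>Pell's equation\<close>

lemma sqrt_int_irrational:
  fixes D :: int
  assumes "D > 0" "\<nexists>k. D = k^2"
  shows "sqrt (of_int D) \<notin> \<rat>"
proof
  assume "sqrt (of_int D) \<in> \<rat>"
  then obtain a b where ab: "sqrt (of_int D) = of_int a / of_int b" "b > 0" "coprime a b"
    by (rule Rats_cases')
  have "of_int D = (sqrt (real_of_int D))^2" using assms by simp
  hence "real_of_int D * of_int b ^ 2 = of_int a ^ 2" using ab by (simp add: field_simps)
  hence eq: "D * b^2 = a^2" by (metis of_int_eq_iff of_int_mult of_int_power)
  hence "b^2 dvd a^2" by (metis dvd_triv_right)
  hence "b dvd a" by simp
  hence "b = 1" using ab by (metis abs_of_pos coprime_absorb_right zdvd1_eq)
  thus False using eq assms by auto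
qed

text \<open>Dirichlet's pigeonhole argument: the infinitely many good approximations h/k of sqrt D
  give h + k sqrt D of bounded norm, so two of them have the same norm n and are congruent modulo n.
  Their quotient is then integral of norm 1.\<close>

lemma pell_exists:
  fixes D :: int
  assumes D: "D > 0" "\<nexists>k. D = k^2"
  obtains x y where "y \<noteq> 0" "x^2 - D * y^2 = 1"
proof -
  define r where "r = sqrt (of_int D)"
  have r: "r > 0" "r^2 = of_int D" and irr: "r \<notin> \<rat>"
    using D sqrt_int_irrational[OF D] by (auto simp: r_def)
  \<comment> \<open>The norm factors as (h - k r)(h + k r). The first factor is below 1/k in
    absolute value, the second at most 1 + 2 k r, and 1/k + 2 r is at most 1 + 2 r.\<close>
  define M where "M = \<lceil>1 + 2 * r\<rceil>"
  define m where "m = (\<lambda>(h, k). h^2 - D * k^2)"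
  \<comment> \<open>The pigeonholes: the norm together with both coordinates modulo the
    norm.\<close>
  define F where "F = (\<lambda>p. (m p, fst p mod m p, snd p mod m p))"
  have bound: "m (h, k) \<noteq> 0 \<and> \<bar>m (h, k)\<bar> \<le> M \<and> k > 0 \<and> coprime h k"
    if hk: "(h, k) \<in> approx_set r" for h k
  proof -
    have k: "k > 0" "coprime h k" and near: "\<bar>r - h / k\<bar> < 1 / (real_of_int k)\<^sup>2"
      using hk by (auto simp: approx_set_def)
    have "\<bar>k * r - h\<bar> = k * \<bar>r - h / k\<bar>"
      using k by (simp add: abs_mult_pos' field_simps)
    also have "\<dots> < k * (1 / (real_of_int k)\<^sup>2)"
      using near k by (intro mult_strict_left_mono) auto
    finally have 1: "\<bar>k * r - h\<bar> < 1 / k"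
      using k by (simp add: power2_eq_square)
    have k1: "1 / real_of_int k \<le> 1" "real_of_int k \<ge> 1" using k by auto
    have kr: "real_of_int k * r > 0" using k r by simp
    hence 2: "\<bar>k * r + h\<bar> \<le> 1 + 2 * k * r" using 1 k1 by linarith
    have "real_of_int (m (h, k)) = h^2 - r^2 * k^2" by (simp add: m_def r)
    also have "\<dots> = - ((k * r - h) * (k * r + h))" by (simp add: algebra_simps power2_eq_square)
    finally have "\<bar>real_of_int (m (h, k))\<bar> = \<bar>k * r - h\<bar> * \<bar>k * r + h\<bar>" by (simp add: abs_mult)
    also have "\<dots> \<le> 1 / k * (1 + 2 * k * r)"
      using 1 2 k by (intro mult_mono) auto
    also have "\<dots> = 1 / k + 2 * r" using k by (simp add: field_simps)
    also have "\<dots> \<le> M" using k1 unfolding M_def by linarith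
    finally have "\<bar>m (h, k)\<bar> \<le> M" by linarith
    moreover have "m (h, k) \<noteq> 0"
    proof
      assume "m (h, k) = 0"
      hence "real_of_int (h^2) = of_int (D * k^2)" by (simp add: m_def)
      hence "(real_of_int h)^2 = (r * k)^2" by (simp add: r power_mult_distrib)
      hence "\<bar>real_of_int h\<bar> = \<bar>r * k\<bar>" by (simp only: power2_eq_iff abs_eq_iff)
      hence "r = real_of_int \<bar>h\<bar> / of_int k" using k r by (simp add: abs_mult field_simps)
      thus False using irr by simp
    qed
    ultimately show ?thesis using k by simp
  qed
  have "F ` approx_set r \<subseteq> {-M..M} \<times> {-M..M} \<times> {-M..M}"
  proof
    fix v assume "v \<in> F ` approx_set r"
    then obtain h k where hk: "(h, k) \<in> approx_set r" "v = F (h, k)" by auto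
    have "\<bar>x mod m (h, k)\<bar> \<le> M" for x
      using bound[OF hk(1)] abs_mod_less[of "m (h, k)" x] by linarith
    from this[of h] this[of k] bound[OF hk(1)] show "v \<in> {-M..M} \<times> {-M..M} \<times> {-M..M}"
      by (auto simp: hk F_def abs_le_iff)
  qed
  hence "finite (F ` approx_set r)" by (rule finite_subset) simp
  moreover have "infinite (approx_set r)"
    using rational_iff_finite_approx_set[of r] irr by simp
  ultimately obtain p where p: "p \<in> approx_set r" "infinite {p' \<in> approx_set r. F p' = F p}"
    using pigeonhole_infinite by blast
  hence "infinite ({p' \<in> approx_set r. F p' = F p} - {p})" by simp
  then obtain p' where p': "p' \<in> approx_set r" "F p' = F p" "p' \<noteq> p"
    using infinite_imp_nonempty by blast
  obtain h k h' k' where hk: "p = (h, k)" "p' = (h', k')" by (cases p, cases p')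
  define n where "n = m p"
  have n: "n = h^2 - D * k^2" "n = h'^2 - D * k'^2" "n \<noteq> 0"
    and cong: "h' mod n = h mod n" "k' mod n = k mod n"
    using p' p bound[of h k] by (auto simp: n_def hk F_def m_def)
  obtain a b where a: "h' = h + n * a" and b: "k' = k + n * b"
    using cong by (metis mod_eqE mult.commute)
  \<comment> \<open>x + y sqrt D is (h' + k' sqrt D) / (h + k sqrt D), that is (h - k sqrt D)(h' +
    k' sqrt D) / n; the congruences make the division by n exact.\<close>
  define x where "x = 1 + h * a - D * k * b"
  define y where "y = h * b - a * k"
  have x: "h * h' - D * k * k' = n * x" 
    unfolding x_def a b n(1) by (simp add: algebra_simps power2_eq_square)
  have y: "h * k' - h' * k = n * y" by (simp add: y_def a b algebra_simps)
  have "n^2 * (x^2 - D * y^2) = (n * x)^2 - D * (n * y)^2" by (simp add: algebra_simps power2_eq_square)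
  also have "\<dots> = (h^2 - D * k^2) * (h'^2 - D * k'^2)"
    unfolding x[symmetric] y[symmetric] by (simp add: algebra_simps power2_eq_square)
  also have "\<dots> = n^2 * 1" using n by (simp add: power2_eq_square)
  finally have "x^2 - D * y^2 = 1" using n(3) by (metis mult_left_cancel power_not_zero)
  \<comment> \<open>If y = 0 then h/k = h'/k'. Approximations in \<open>approx_set\<close> are
    reduced with positive denominator, so the two would be equal.\<close>
  moreover have "y \<noteq> 0"
  proof
    assume "y = 0"
    hence eq: "h * k' = h' * k" using y by simp
    have c: "k > 0" "coprime h k" "k' > 0" "coprime h' k'"
      using bound p p' hk by auto
    have "k dvd k'" "k' dvd k"
      using eq c by (metis coprime_commute coprime_dvd_mult_right_iff dvd_triv_right,
          metis coprime_commute coprime_dvd_mult_right_iff dvd_triv_right)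
    hence "k = k'" using c zdvd_antisym_nonneg by simp
    thus False using eq c p' hk by simp
  qed
  ultimately show ?thesis using that by blast
qed

text \<open>As D u^2 = t^2 - 4, a solution with least t also has least u. This makes the description
  in \<open>smallest_pell4\<close> satisfiable, and minimality in both coordinates makes it
  unique.\<close>

lemma smallest_pell4:
  fixes D :: int
  assumes D: "D > 0" "\<nexists>k. D = k^2"
  obtains T U where "smallest_pell4 D = (T, U)" "pell4 D T U"
    "\<And>t u. pell4 D t u \<Longrightarrow> T \<le> t \<and> U \<le> u"
proof -
  define P where "P = (\<lambda>(T, U). pell4 D T U \<and> (\<forall>t u. pell4 D t u \<longrightarrow> T \<le> t \<and> U \<le> u))"
  obtain x y where xy: "y \<noteq> 0" "x^2 - D * y^2 = 1" using pell_exists[OF D] .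
  have "x \<noteq> 0"
  proof
    assume "x = 0"
    hence "D * y^2 = -1" using xy by simp
    moreover have "D * y^2 \<ge> 0" using D by simp
    ultimately show False by linarith
  qed
  \<comment> \<open>Doubling a solution of norm 1 gives one of norm 4.\<close>
  hence "pell4 D (2 * \<bar>x\<bar>) (2 * \<bar>y\<bar>)" using xy by (simp add: pell4_def power_mult_distrib)
  hence "(\<lambda>(t, u). pell4 D t u) (2 * \<bar>x\<bar>, 2 * \<bar>y\<bar>)" by simp
  from ex_has_least_nat[of "\<lambda>(t, u). pell4 D t u", OF this, of "\<lambda>(t, u). nat t"]
  obtain T U where TU: "pell4 D T U" "\<And>t u. pell4 D t u \<Longrightarrow> nat T \<le> nat t" by auto
  have T: "T \<le> t" if "pell4 D t u" for t u
    using TU(2)[OF that] that unfolding pell4_def by linarith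
  have U: "U \<le> u" if tu: "pell4 D t u" for t u
  proof -
    have "T^2 \<le> t^2" using T[OF tu] TU(1) by (intro power_mono) (auto simp: pell4_def)
    moreover have "T^2 = 4 + D * U^2" "t^2 = 4 + D * u^2" using TU(1) tu by (auto simp: pell4_def)
    ultimately have "D * U^2 \<le> D * u^2" by linarith
    hence "U^2 \<le> u^2" using D by simp
    thus ?thesis by (rule power2_le_imp_le) (use tu in \<open>simp add: pell4_def\<close>)
  qed
  have "P (T, U)" using TU(1) T U by (auto simp: P_def)
  moreover have "p = (T, U)" if "P p" for p
  proof -
    obtain t u where p: "p = (t, u)" by (cases p)
    have "pell4 D t u" "T \<ge> t" "U \<ge> u" using that TU(1) by (auto simp: P_def p)
    thus ?thesis using T U by (force simp: p)
  qed
  ultimately have "smallest_pell4 D = (T, U)"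
    unfolding smallest_pell4_def P_def[symmetric] by (rule the_equality)
  thus ?thesis using that TU(1) T U by blast
qed

section \<open>Geodesics\<close>

text \<open>The map w \<mapsto> (s + w f) / (1 + w) sends 0 to s, infinity to f and the imaginary
  axis to the circle of the geodesic. Its determinant is f - s, so for f < s the lower half axis is
  needed, whence the sign in w. In this form a matrix acts by multiplication.\<close>

lemma geodesic_path_alt:
  fixes s f t :: real
  assumes "s \<noteq> f"
  defines "w \<equiv> \<i> * of_real (sgn (f - s) * exp t)"
  shows "geodesic_path (s, f) t = (of_real s + w * of_real f) / (1 + w)" "1 + w \<noteq> 0"
proof -
  define e where "e = exp t"
  have e: "e > 0" by (simp add: e_def)
  define \<sigma> where "\<sigma> = sgn (f - s)"
  have \<sigma>: "\<sigma> * \<sigma> = 1" "\<bar>f - s\<bar> = \<sigma> * (f - s)" using assms by (auto simp: \<sigma>_def sgn_if)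
  define T where "T = tanh t"
  define S where "S = 1 / cosh t"
  have pos: "e * e + 1 \<noteq> 0" using e by (smt (verit) mult_pos_pos)
  have "sinh t = (e * e - 1) / (2 * e)" "cosh t = (e * e + 1) / (2 * e)"
    using e by (simp_all add: sinh_field_def cosh_field_def e_def[symmetric] exp_minus field_simps)
  hence T: "T = (e * e - 1) / (e * e + 1)" and S: "S = 2 * e / (e * e + 1)"
    using e pos by (simp_all add: T_def S_def tanh_def)
  \<comment> \<open>These two identities are the real and imaginary parts of path * (1 + w) = s + w
    f.\<close>
  have TS: "T - S * e = -1" "S + e * T = e"
    using pos unfolding T S by (simp_all add: divide_simps) (simp_all add: algebra_simps)
  have p: "geodesic_path (s, f) t = Complex ((s + f) / 2 + (f - s) / 2 * T) (\<sigma> * (f - s) / 2 * S)"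
    by (simp add: T_def S_def \<sigma>(2))
  have "\<sigma> * (f - s) / 2 * S * (\<sigma> * e) = (\<sigma> * \<sigma>) * ((f - s) / 2 * (S * e))"
    by (simp only: mult_ac times_divide_eq_right times_divide_eq_left)
  hence Se: "\<sigma> * (f - s) / 2 * S * (\<sigma> * e) = (f - s) / 2 * (S * e)" unfolding \<sigma>(1) by simp
  have "(s + f) / 2 + (f - s) / 2 * T - \<sigma> * (f - s) / 2 * S * (\<sigma> * e)
      = (s + f) / 2 + (f - s) / 2 * (T - S * e)"
    unfolding Se by (simp only: right_diff_distrib add_diff_eq)
  hence re: "(s + f) / 2 + (f - s) / 2 * T - \<sigma> * (f - s) / 2 * S * (\<sigma> * e) = s"
    unfolding TS by (simp add: field_simps)
  have "((s + f) / 2 + (f - s) / 2 * T) * (\<sigma> * e) + \<sigma> * (f - s) / 2 * S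
     = \<sigma> * ((s + f) / 2 * e + (f - s) / 2 * (S + e * T))" by (simp add: field_simps)
  hence im: "((s + f) / 2 + (f - s) / 2 * T) * (\<sigma> * e) + \<sigma> * (f - s) / 2 * S = \<sigma> * e * f"
    unfolding TS by (simp add: field_simps)
  have w: "w = \<i> * of_real (\<sigma> * e)" by (simp add: w_def \<sigma>_def e_def)
  show w1: "1 + w \<noteq> 0" by (simp add: w complex_eq_iff)
  have "geodesic_path (s, f) t * (1 + w) = of_real s + w * of_real f"
    unfolding p w using re im by (simp add: complex_eq_iff algebra_simps)
  thus "geodesic_path (s, f) t = (of_real s + w * of_real f) / (1 + w)"
    using w1 by (simp add: nonzero_eq_divide_eq)
qed

lemma moebius_diff:
  fixes x y :: real
  assumes "\<gamma> \<in> SL2Z" "\<gamma>$2$1 * x + \<gamma>$2$2 \<noteq> 0" "\<gamma>$2$1 * y + \<gamma>$2$2 \<noteq> 0"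
  shows "moebius \<gamma> y - moebius \<gamma> x = (y - x) / ((\<gamma>$2$1 * x + \<gamma>$2$2) * (\<gamma>$2$1 * y + \<gamma>$2$2))"
proof -
  have det: "of_int (\<gamma>$1$1) * of_int (\<gamma>$2$2) - of_int (\<gamma>$1$2) * of_int (\<gamma>$2$1) = (1::real)"
    using assms(1) by (simp add: SL2Z_iff flip: of_int_mult of_int_diff)
  have "(of_int (\<gamma>$1$1) * y + of_int (\<gamma>$1$2)) * (of_int (\<gamma>$2$1) * x + of_int (\<gamma>$2$2))
      - (of_int (\<gamma>$1$1) * x + of_int (\<gamma>$1$2)) * (of_int (\<gamma>$2$1) * y + of_int (\<gamma>$2$2))
    = (of_int (\<gamma>$1$1) * of_int (\<gamma>$2$2) - of_int (\<gamma>$1$2) * of_int (\<gamma>$2$1)) * (y - x)"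
    by (simp add: algebra_simps)
  thus ?thesis unfolding det moebius_def using assms(2,3)
    by (simp add: diff_frac_eq mult.commute)
qed

text \<open>Applying \<gamma> to (s + w f) / (1 + w) gives (p + w q) / (x + w y), the same shape for
  the new endpoints p/x, q/y with w' = w y / x. Scaling w by |y / x| shifts the parameter by its
  logarithm.\<close>

lemma moebius_geodesic_path:
  fixes s f t :: real
  assumes "s \<noteq> f" "\<gamma> \<in> SL2Z" "\<gamma>$2$1 * s + \<gamma>$2$2 \<noteq> 0" "\<gamma>$2$1 * f + \<gamma>$2$2 \<noteq> 0"
  shows "moebius \<gamma> (geodesic_path (s, f) t) = geodesic_path (translate_geodesic \<gamma> (s, f))
    (t + ln \<bar>(\<gamma>$2$1 * f + \<gamma>$2$2) / (\<gamma>$2$1 * s + \<gamma>$2$2)\<bar>)"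
proof -
  define x y where "x = \<gamma>$2$1 * s + \<gamma>$2$2" and "y = \<gamma>$2$1 * f + \<gamma>$2$2"
  define p q where "p = \<gamma>$1$1 * s + \<gamma>$1$2" and "q = \<gamma>$1$1 * f + \<gamma>$1$2"
  define w where "w = \<i> * complex_of_real (sgn (f - s) * exp t)"
  define t' where "t' = t + ln \<bar>y / x\<bar>"
  have xy: "x \<noteq> 0" "y \<noteq> 0" using assms by (simp_all add: x_def y_def)
  have m: "moebius \<gamma> s = p / x" "moebius \<gamma> f = q / y"
    by (simp_all add: moebius_def x_def y_def p_def q_def)
  have diff: "q / y - p / x = (f - s) / (x * y)"
    using moebius_diff[OF assms(2-4)] unfolding m x_def[symmetric] y_def[symmetric] .
  have ne: "p / x \<noteq> q / y" using diff xy assms(1) by auto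
  define w' where "w' = \<i> * complex_of_real (sgn (q / y - p / x) * exp t')"
  \<comment> \<open>The sign of y / x is the one by which the difference of the endpoints changes,
    because the new difference is (f - s) / (x y).\<close>
  have "sgn (q / y - p / x) * exp t' = sgn (f - s) * exp t * (sgn (x * y) * \<bar>y / x\<bar>)"
    using xy by (simp add: diff t'_def exp_add sgn_divide sgn_mult)
       (simp add: sgn_if)
  also have "sgn (x * y) * \<bar>y / x\<bar> = y / x" 
    using xy by (cases x "0::real" rule: linorder_cases; cases y "0::real" rule: linorder_cases)
      (simp_all add: sgn_mult)
  finally have w': "w' = w * of_real y / of_real x" by (simp add: w'_def w_def)
  have z: "geodesic_path (s, f) t = (of_real s + w * of_real f) / (1 + w)" and w1: "1 + w \<noteq> 0"
    unfolding w_def by (rule geodesic_path_alt[OF assms(1)])+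
  have z': "geodesic_path (p / x, q / y) t' = (of_real (p / x) + w' * of_real (q / y)) / (1 + w')"
    and w'1: "1 + w' \<noteq> 0"
    unfolding w'_def by (rule geodesic_path_alt[OF ne])+
  have n: "of_real x + w * of_real y \<noteq> 0" using xy w'1 by (simp add: w' field_simps)
  have "moebius \<gamma> (geodesic_path (s, f) t)
      = ((of_real p + w * of_real q) / (1 + w)) / ((of_real x + w * of_real y) / (1 + w))"
    unfolding moebius_def z using w1
    by (simp add: x_def y_def p_def q_def add_divide_eq_iff field_simps)
  also have "\<dots> = (of_real p + w * of_real q) / (of_real x + w * of_real y)" using w1 by simp
  also have "\<dots> = geodesic_path (p / x, q / y) t'"
    unfolding z' w' using xy n w'1 unfolding w' by (simp add: divide_simps)
  finally show ?thesis
    by (simp add: translate_geodesic_def m t'_def x_def y_def del: geodesic_path.simps)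
qed

section \<open>Segments, tangent vectors and transversality\<close>

lemma geodesic_path_inj:
  assumes "s \<noteq> f"
  shows "geodesic_path (s, f) t = geodesic_path (s, f) u \<longleftrightarrow> t = u"
  using assms by auto

lemma half_open_segment_eq:
  assumes "s \<noteq> f" "t\<^sub>0 < t\<^sub>1"
  shows "half_open_segment (s, f) (geodesic_path (s, f) t\<^sub>0) (geodesic_path (s, f) t\<^sub>1) =
    geodesic_path (s, f) ` {t\<^sub>0..<t\<^sub>1}"
  unfolding half_open_segment_def geodesic_path_inj[OF assms(1)]
  using assms(2) by (auto simp: closed_segment_eq_real_ivl simp del: geodesic_path.simps)

text \<open>The tangent is the Euclidean radius turned by a right angle. Collinearity of tangents
  thus becomes collinearity of radii.\<close>

lemma vector_derivative_geodesic_path: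
  "vector_derivative (geodesic_path (s, f)) (at t) =
    (- sgn (f - s) / cosh t) *\<^sub>R (\<i> * (geodesic_path (s, f) t - of_real ((s + f) / 2)))"
proof -
  have c: "cosh t \<noteq> 0" by simp
  have "((\<lambda>t. (s + f) / 2 + (f - s) / 2 * tanh t) has_real_derivative
      (f - s) / 2 * (1 - tanh t ^ 2)) (at t)"
    using c by (auto intro!: derivative_eq_intros)
  moreover have "((\<lambda>t. \<bar>f - s\<bar> / (2 * cosh t)) has_real_derivative
      - (\<bar>f - s\<bar> / 2 * sinh t / cosh t ^ 2)) (at t)"
    using c by (auto intro!: derivative_eq_intros simp: field_simps power2_eq_square)
  ultimately have "(geodesic_path (s, f) has_vector_derivative
     Complex ((f - s) / 2 * (1 - tanh t ^ 2)) (- (\<bar>f - s\<bar> / 2 * sinh t / cosh t ^ 2))) (at t)"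
    by (simp add: has_vector_derivative_complex_iff has_real_derivative_iff_has_vector_derivative)
  hence "vector_derivative (geodesic_path (s, f)) (at t) =
     Complex ((f - s) / 2 * (1 - tanh t ^ 2)) (- (\<bar>f - s\<bar> / 2 * sinh t / cosh t ^ 2))"
    by (rule vector_derivative_at)
  also have "1 - tanh t ^ 2 = 1 / cosh t ^ 2" using tanh_cosh_square[of t] by linarith
  finally have eq: "vector_derivative (geodesic_path (s, f)) (at t) =
     Complex ((f - s) / 2 * (1 / cosh t ^ 2)) (- (\<bar>f - s\<bar> / 2 * sinh t / cosh t ^ 2))" .
  show ?thesis
    unfolding eq by (simp add: complex_eq_iff tanh_def power2_eq_square sgn_if field_simps)
qed

text \<open>At a common point P the radii from the two centres are parallel only if the centres
  agree, as both centres are real and Im P > 0. Concentric semicircles through P coincide, which is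
  the case that transversality excludes.\<close>

lemma transverse_points_eq:
  assumes "s \<noteq> f" "s' \<noteq> f'"
  shows "transverse_points (s, f) (s', f') =
    (if s + f = s' + f' then {} else geodesic_points (s, f) \<inter> geodesic_points (s', f'))"
proof -
  have "collinear {0, vector_derivative (geodesic_path (s, f)) (at t),
      vector_derivative (geodesic_path (s', f')) (at u)} \<longleftrightarrow> s + f = s' + f'"
    if eq: "geodesic_path (s, f) t = P" "geodesic_path (s', f') u = P" for t u P
  proof -
    define c c' where "c = (s + f) / 2" and "c' = (s' + f') / 2"
    have P: "Im P > 0" using eq(1) assms(1) by auto
    have ne: "P - of_real c \<noteq> 0" using P by (auto simp: complex_eq_iff)
    have "collinear {0, vector_derivative (geodesic_path (s, f)) (at t),
      vector_derivative (geodesic_path (s', f')) (at u)} \<longleftrightarrow>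
      collinear {0, \<i> * (P - of_real c), \<i> * (P - of_real c')}"
      unfolding vector_derivative_geodesic_path eq c_def[symmetric] c'_def[symmetric]
        collinear_scaleR_iff using assms by (simp add: sgn_if)
    also have "\<dots> \<longleftrightarrow> (P - of_real c') / (P - of_real c) \<in> \<real>"
      by (simp add: collinear_iff_Reals)
    also have "\<dots> \<longleftrightarrow> Im ((P - of_real c') / (P - of_real c)) = 0"
      by (simp add: complex_is_Real_iff)
    also have "\<dots> \<longleftrightarrow> Im P * (c' - c) = 0"
      using ne P by (simp add: Im_divide complex_eq_iff sum_power2_eq_zero_iff algebra_simps)
        (use P in auto)?
    also have "\<dots> \<longleftrightarrow> s + f = s' + f'" using P by (auto simp: c_def c'_def)
    finally show ?thesis .
  qed
  hence "transverse_points (s, f) (s', f') =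
      {P. s + f \<noteq> s' + f' \<and> (\<exists>t u. geodesic_path (s, f) t = P \<and> geodesic_path (s', f') u = P)}"
    unfolding transverse_points_def by blast
  moreover have "geodesic_points (s, f) \<inter> geodesic_points (s', f') =
      {P. \<exists>t u. geodesic_path (s, f) t = P \<and> geodesic_path (s', f') u = P}"
    unfolding geodesic_points_def
    by (rule set_eqI) (simp only: Int_iff image_iff mem_Collect_eq bex_UNIV, metis)
  ultimately show ?thesis by (simp del: geodesic_path.simps)
qed

section \<open>Root geodesics\<close>

lemma root_geodesic_endpoints:
  assumes "indefinite (A, B, C)" and "root_geodesic (A, B, C) = (s, f)"
  shows "f - s = sqrt (disc (A, B, C)) / A" "s + f = - B / A" "s \<noteq> f"
proof -
  have A: "A \<noteq> 0" using assms by (rule_tac indefinite_fst_nonzero)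
  show *: "f - s = sqrt (disc (A, B, C)) / A" "s + f = - B / A"
    using assms(2) A by (auto simp: root_geodesic_def field_simps)
  have "disc (A, B, C) > 0" using assms(1) by (simp add: indefinite_def)
  hence "sqrt (disc (A, B, C)) / A \<noteq> 0" using A by (simp del: disc.simps)
  thus "s \<noteq> f" using * by auto
qed

text \<open>The signed difference sqrt D / A of the endpoints yields A, so orientation tells a form
  from its negative; the sum yields B and the discriminant C.\<close>

lemma root_geodesic_inj:
  assumes "indefinite q" "disc q' = disc q" "root_geodesic q = root_geodesic q'"
  shows "q = q'"
proof -
  obtain A B C where q: "q = (A, B, C)" by (cases q)
  obtain A' B' C' where q': "q' = (A', B', C')" by (cases q')
  obtain s f where sf: "root_geodesic q = (s, f)" by (cases "root_geodesic q")
  have ind: "indefinite (A, B, C)" "indefinite (A', B', C')" using assms(1,2) by (auto simp: indefinite_def q q')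
  have A: "A \<noteq> 0" "A' \<noteq> 0" using ind indefinite_fst_nonzero by blast+
  note e = root_geodesic_endpoints[OF ind(1) sf[unfolded q]]
  note e' = root_geodesic_endpoints[OF ind(2) sf[unfolded assms(3) q']]
  have d: "disc (A', B', C') = disc (A, B, C)" using assms(2) by (simp only: q q')
  have "sqrt (disc (A, B, C)) / A = sqrt (disc (A, B, C)) / A'"
    using e(1) e'(1) unfolding d by (rule subst)
  moreover have "sqrt (disc (A, B, C)) \<noteq> 0"
    using ind(1) unfolding indefinite_def by (simp del: disc.simps)
  ultimately have AA: "A' = A" by (simp add: divide_inverse del: disc.simps)
  have "- real_of_int B / A = - real_of_int B' / A'" using e(2) e'(2) by simp
  hence BB: "B' = B" using A AA by simp
  have "4 * A * C = 4 * A * C'" using assms(2) by (auto simp: q q' AA BB)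
  thus ?thesis using A by (simp add: q q' AA BB)
qed

text \<open>The circle equation after completing the square. It is linear in |z|^2 and Re z.\<close>

lemma geodesic_points_root_geodesic:
  assumes "indefinite (A, B, C)"
  shows "geodesic_points (root_geodesic (A, B, C)) =
    {z. Im z > 0 \<and> A * ((Re z)^2 + (Im z)^2) + B * Re z + C = 0}"
proof -
  obtain s f where sf: "root_geodesic (A, B, C) = (s, f)" by (cases "root_geodesic (A, B, C)")
  note e = root_geodesic_endpoints[OF assms sf]
  have A: "A \<noteq> 0" using assms by (rule indefinite_fst_nonzero)
  have "cmod (z - of_real ((s + f) / 2)) = \<bar>f - s\<bar> / 2 \<longleftrightarrow>
      A * ((Re z)^2 + (Im z)^2) + B * Re z + C = 0" for z
  proof -
    have "cmod (z - of_real ((s + f) / 2)) = \<bar>f - s\<bar> / 2 \<longleftrightarrow>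
        (cmod (z - of_real ((s + f) / 2)))^2 = (\<bar>f - s\<bar> / 2)^2"
      by (simp add: power2_eq_iff_nonneg)
    also have "(cmod (z - of_real ((s + f) / 2)))^2 = (Re z + B / (2 * A))^2 + (Im z)^2"
      by (simp add: cmod_power2 e(2) mult.commute)
    also have "(\<bar>f - s\<bar> / 2)^2 = of_int (disc (A, B, C)) / (4 * A^2)"
    proof -
      have "disc (A, B, C) > 0" using assms by (simp add: indefinite_def)
      hence "sqrt (disc (A, B, C)) ^ 2 = of_int (disc (A, B, C))" by (simp del: disc.simps)
      thus ?thesis unfolding e by (simp add: power_divide mult.commute del: disc.simps)
    qed
    also have "(Re z + B / (2 * A))^2 + (Im z)^2 = of_int (disc (A, B, C)) / (4 * A^2) \<longleftrightarrow>
        4 * A * (A * ((Re z)^2 + (Im z)^2) + B * Re z + C) = 0"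
      using A by (simp add: field_simps power2_eq_square)
    also have "\<dots> \<longleftrightarrow> A * ((Re z)^2 + (Im z)^2) + B * Re z + C = 0" using A by simp
    finally show ?thesis .
  qed
  thus ?thesis unfolding sf geodesic_points_eq[OF e(3)] by simp
qed

text \<open>On two root geodesics \<open>N = |z|\<^sup>2\<close> and \<open>x = Re z\<close> solve a linear system, and
  \<open>4 (N - x\<^sup>2)\<close> times the squared determinant is \<open>D D' - B_Delta q q'\<^sup>2\<close>.\<close>

lemma transverse_points_root_geodesic:
  assumes "indefinite q" "indefinite q'"
  shows "if \<bar>real_of_int (B_Delta q q')\<bar> < sqrt (of_int (disc q * disc q'))
    then \<exists>P. transverse_points (root_geodesic q) (root_geodesic q') = {P} \<and>
      geodesic_points (root_geodesic q) \<inter> geodesic_points (root_geodesic q') = {P}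
    else transverse_points (root_geodesic q) (root_geodesic q') = {}"
proof -
  obtain A B C where q: "q = (A, B, C)" by (cases q)
  obtain A' B' C' where q': "q' = (A', B', C')" by (cases q')
  obtain s f where sf: "root_geodesic q = (s, f)" by (cases "root_geodesic q")
  obtain s' f' where sf': "root_geodesic q' = (s', f')" by (cases "root_geodesic q'")
  note ind = assms[unfolded q q']
  have A: "A \<noteq> 0" "A' \<noteq> 0" using ind indefinite_fst_nonzero by blast+
  note e = root_geodesic_endpoints[OF ind(1) sf[unfolded q]]
  note e' = root_geodesic_endpoints[OF ind(2) sf'[unfolded q']]
  define w where "w = A * B' - A' * B"
  \<comment> \<open>By Cramer's rule w Re z = A' C - A C' and w |z|^2 = B C' - B' C at a common
    point, so K is the value that (w Im z)^2 must take.\<close>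
  define K where "K = (B * C' - B' * C) * w - (A' * C - A * C')^2"
  have K: "disc q * disc q' - (B_Delta q q')^2 = 4 * K"
    by (simp add: q q' K_def w_def power2_eq_square algebra_simps)
  have "\<bar>real_of_int (B_Delta q q')\<bar> < sqrt (of_int (disc q * disc q')) \<longleftrightarrow>
      real_of_int ((B_Delta q q')^2) < of_int (disc q * disc q')"
    by (metis of_int_power real_sqrt_abs real_sqrt_less_iff)
  also have "\<dots> \<longleftrightarrow> K > 0" using K unfolding of_int_less_iff by linarith
  finally have cond: "\<bar>real_of_int (B_Delta q q')\<bar> < sqrt (of_int (disc q * disc q')) \<longleftrightarrow> K > 0" .
  have "s + f = s' + f' \<longleftrightarrow> real_of_int (A * B') = of_int (A' * B)"
    unfolding e(2) e'(2) using A by (auto simp: field_simps)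
  hence sum: "s + f = s' + f' \<longleftrightarrow> w = 0" unfolding of_int_eq_iff by (simp add: w_def)
  define X where "X = geodesic_points (root_geodesic q) \<inter> geodesic_points (root_geodesic q')"
  have tr: "transverse_points (root_geodesic q) (root_geodesic q') = (if w = 0 then {} else X)"
    unfolding sf sf' transverse_points_eq[OF e(3) e'(3)] sum by (simp add: X_def sf sf')
  have X: "z \<in> X \<longleftrightarrow> Im z > 0 \<and> A * ((Re z)^2 + (Im z)^2) + B * Re z + C = 0 \<and>
      A' * ((Re z)^2 + (Im z)^2) + B' * Re z + C' = 0" for z
    unfolding X_def q q' geodesic_points_root_geodesic[OF ind(1)] geodesic_points_root_geodesic[OF ind(2)]
    by auto
  have Xw: "z \<in> X \<longleftrightarrow> Im z > 0 \<and> w * Re z = A' * C - A * C' \<and> (w * Im z)^2 = K" if "w \<noteq> 0" for z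
  proof -
    define x N where "x = Re z" and "N = (Re z)^2 + (Im z)^2"
    have w: "real_of_int w = A * B' - A' * B" "real_of_int w \<noteq> 0"
      using that by (simp add: w_def, simp)
    have "A * N + B * x + C = 0 \<and> A' * N + B' * x + C' = 0 \<longleftrightarrow>
        w * x = A' * C - A * C' \<and> w * N = B * C' - B' * C"
    proof safe
      assume *: "A * N + B * x + C = 0" "A' * N + B' * x + C' = 0"
      show "w * x = A' * C - A * C'"
        using * unfolding w of_int_diff of_int_mult by algebra
      show "w * N = B * C' - B' * C"
        using * unfolding w of_int_diff of_int_mult by algebra
    next
      assume *: "w * x = A' * C - A * C'" "w * N = B * C' - B' * C"
      have "w * (A * N + B * x + C) = A * (w * N) + B * (w * x) + w * C"
        "w * (A' * N + B' * x + C') = A' * (w * N) + B' * (w * x) + w * C'"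
        by (simp_all add: algebra_simps)
      moreover have "A * (w * N) + B * (w * x) + w * C = 0" "A' * (w * N) + B' * (w * x) + w * C' = 0"
        unfolding * by (simp_all add: w(1) algebra_simps)
      ultimately have "w * (A * N + B * x + C) = 0" "w * (A' * N + B' * x + C') = 0"
        by (simp_all only:)
      thus "A * N + B * x + C = 0" "A' * N + B' * x + C' = 0" using w(2) by simp_all
    qed
    also have "\<dots> \<longleftrightarrow> w * x = A' * C - A * C' \<and> w * (w * N) = w * (B * C' - B' * C)"
      using w(2) by simp
    also have "\<dots> \<longleftrightarrow> w * x = A' * C - A * C' \<and> (w * Im z)^2 = K"
    proof (intro conj_cong refl)
      assume "w * x = A' * C - A * C'"
      hence "real_of_int ((A' * C - A * C')^2) = (w * x)^2" by simp
      moreover have "w * (w * N) = (w * x)^2 + (w * Im z)^2"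
        by (simp add: N_def x_def power2_eq_square algebra_simps)
      ultimately show "w * (w * N) = w * (B * C' - B' * C) \<longleftrightarrow> (w * Im z)^2 = K"
        by (simp add: K_def mult.commute) linarith
    qed
    finally show ?thesis unfolding X by (simp add: x_def N_def)
  qed
  show ?thesis
  proof (cases "K > 0")
    case True
    \<comment> \<open>For w = 0 only the negated square in K remains, so the inequality by itself
      excludes equal centres.\<close>
    hence w: "w \<noteq> 0" by (auto simp: K_def dest: order.strict_trans2[OF _ zero_le_power2])
    define P where "P = Complex ((A' * C - A * C') / w) (sqrt K / \<bar>w\<bar>)"
    have "z \<in> X \<longleftrightarrow> z = P" for z
    proof
      assume "z = P"
      thus "z \<in> X" unfolding Xw[OF w] using w True
        by (simp add: P_def power_mult_distrib power_divide)
    next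
      assume "z \<in> X"
      hence z: "Im z > 0" "w * Re z = A' * C - A * C'" "(w * Im z)^2 = K"
        unfolding Xw[OF w] by auto
      have "sqrt K = \<bar>w\<bar> * Im z" using z(1) unfolding z(3)[symmetric] by (simp add: abs_mult)
      thus "z = P" using z(2) w by (simp add: P_def complex_eq_iff field_simps)
    qed
    hence "X = {P}" by auto
    thus ?thesis using cond True w unfolding tr by (auto simp: X_def[symmetric])
  next
    case False
    \<comment> \<open>For w = 0 the geodesics may coincide and X need not be empty, but then there
      is no transverse point.\<close>
    have "X = {}" if "w \<noteq> 0"
    proof (rule ccontr)
      assume "X \<noteq> {}"
      then obtain z where "z \<in> X" by auto
      hence "Im z > 0" "(w * Im z)^2 = K" unfolding Xw[OF that] by auto
      moreover have "(w * Im z)^2 > 0" using \<open>Im z > 0\<close> that by simp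
      ultimately show False using False by simp
    qed
    thus ?thesis using cond False unfolding tr by auto
  qed
qed

text \<open>\<gamma> sends roots of the new form to roots of the old one. With e either square root
  of the discriminant, both roots are covered at once and first roots go to first roots, so
  orientation is kept.\<close>

lemma root_act_bqf:
  fixes e r :: real
  assumes \<gamma>: "\<gamma> \<in> SL2Z" and ind: "indefinite (A, B, C)" and act: "act_bqf \<gamma> (A, B, C) = (A', B', C')"
    and e: "e^2 = disc (A, B, C)"
  defines "r \<equiv> (- real_of_int B' + e) / (2 * real_of_int A')"
  shows "moebius \<gamma> r = (- real_of_int B + e) / (2 * real_of_int A)" "\<gamma>$2$1 * r + \<gamma>$2$2 \<noteq> 0"
proof -
  define a b c d where abcd: "a = real_of_int (\<gamma>$1$1)" "b = real_of_int (\<gamma>$1$2)"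
    "c = real_of_int (\<gamma>$2$1)" "d = real_of_int (\<gamma>$2$2)"
  have det: "a * d - b * c = 1"
    using \<gamma> by (simp add: SL2Z_iff abcd flip: of_int_mult of_int_diff)
  have "indefinite (A', B', C')" using indefinite_act_bqf[OF \<gamma>, of "(A, B, C)"] ind act by simp
  hence A: "A \<noteq> 0" "A' \<noteq> 0" using ind indefinite_fst_nonzero by blast+
  have A': "real_of_int A' = A * a^2 + B * a * c + C * c^2"
    and B': "real_of_int B' = 2 * A * a * b + B * (a * d + b * c) + 2 * C * c * d"
    using act by (auto simp: Let_def abcd)
  have e2: "e^2 = B^2 - 4 * A * C" using e by simp
  have "2 * d * A' - c * B' = (2 * A * a + B * c) * (a * d - b * c)"
    "2 * b * A' - a * B' = - (2 * C * c + B * a) * (a * d - b * c)"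
    unfolding A' B' by (simp_all add: algebra_simps power2_eq_square)
  hence *: "2 * d * A' - c * B' = 2 * A * a + B * c" "2 * b * A' - a * B' = - (2 * C * c + B * a)"
    unfolding det by simp_all
  have den: "c * r + d = (2 * A * a + B * c + c * e) / (2 * A')"
    and num: "a * r + b = (- (2 * C * c + B * a) + a * e) / (2 * A')"
    unfolding r_def *[symmetric] using A by (simp_all add: field_simps)
  \<comment> \<open>The denominator times its conjugate is 4 A A', hence it does not vanish.\<close>
  have "(2 * A * a + B * c + c * e) * (2 * A * a + B * c - c * e) = (2 * A * a + B * c)^2 - c^2 * e^2"
    by (simp add: algebra_simps power2_eq_square)
  also have "\<dots> = 4 * real_of_int A * real_of_int A'" unfolding e2 A' by (simp add: algebra_simps power2_eq_square)
  finally have ne: "2 * A * a + B * c + c * e \<noteq> 0" using A by auto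
  thus "\<gamma>$2$1 * r + \<gamma>$2$2 \<noteq> 0" using den A by (simp add: abcd)
  have "(- B + e) * (2 * A * a + B * c + c * e)
      = - 2 * A * B * a + 2 * A * a * e + c * (e^2 - B^2)"
    by (simp add: algebra_simps power2_eq_square)
  also have "\<dots> = (- (2 * C * c + B * a) + a * e) * (2 * A)"
    unfolding e2 by (simp add: algebra_simps power2_eq_square)
  finally have "(- (2 * C * c + B * a) + a * e) / (2 * A * a + B * c + c * e) = (- B + e) / (2 * A)"
    using ne A by (simp add: frac_eq_eq)
  thus "moebius \<gamma> r = (- real_of_int B + e) / (2 * real_of_int A)"
    unfolding moebius_def abcd[symmetric] num den using A by simp
qed

lemma root_geodesic_act_bqf:
  fixes s f :: real
  assumes "\<gamma> \<in> SL2Z" "indefinite q" "root_geodesic (act_bqf \<gamma> q) = (s, f)"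
  shows "root_geodesic q = translate_geodesic \<gamma> (s, f)"
    "\<gamma>$2$1 * s + \<gamma>$2$2 \<noteq> 0" "\<gamma>$2$1 * f + \<gamma>$2$2 \<noteq> 0"
proof -
  obtain A B C where q: "q = (A, B, C)" by (cases q)
  obtain A' B' C' where q': "act_bqf \<gamma> q = (A', B', C')" by (cases "act_bqf \<gamma> q")
  define R where "R = sqrt (disc (A, B, C))"
  have R': "R = sqrt (disc (A', B', C'))"
    using disc_act_bqf[OF assms(1), of q] by (simp only: R_def q[symmetric] q'[symmetric])
  have "disc (A, B, C) > 0" using assms(2) by (simp add: indefinite_def q)
  hence R2: "R^2 = disc (A, B, C)" "(- R)^2 = disc (A, B, C)"
    by (simp_all add: R_def del: disc.simps)
  have sf: "s = (- real_of_int B' + - R) / (2 * real_of_int A')"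
    "f = (- real_of_int B' + R) / (2 * real_of_int A')"
    using assms(3) by (simp_all add: q' root_geodesic_def R')
  note 1 = root_act_bqf[OF assms(1) assms(2)[unfolded q] q'[unfolded q] R2(1)]
  note 2 = root_act_bqf[OF assms(1) assms(2)[unfolded q] q'[unfolded q] R2(2)]
  show "\<gamma>$2$1 * s + \<gamma>$2$2 \<noteq> 0" "\<gamma>$2$1 * f + \<gamma>$2$2 \<noteq> 0"
    unfolding sf using 1(2) 2(2) by -
  show "root_geodesic q = translate_geodesic \<gamma> (s, f)"
    using 1(1) 2(1) unfolding sf by (simp add: translate_geodesic_def root_geodesic_def q R_def)
qed

lemma moebius_geodesic_points:
  assumes "\<gamma> \<in> SL2Z" "indefinite q" "z \<in> geodesic_points (root_geodesic (act_bqf \<gamma> q))"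
  shows "moebius \<gamma> z \<in> geodesic_points (root_geodesic q)"
proof -
  obtain s f where sf: "root_geodesic (act_bqf \<gamma> q) = (s, f)" by (cases "root_geodesic (act_bqf \<gamma> q)")
  obtain A B C where q': "act_bqf \<gamma> q = (A, B, C)" by (cases "act_bqf \<gamma> q")
  have "s \<noteq> f" using root_geodesic_endpoints(3)[of A B C s f] sf assms(1,2) by (metis indefinite_act_bqf q')
  moreover obtain t where "z = geodesic_path (s, f) t"
    using assms(3) by (auto simp: geodesic_points_def sf simp del: geodesic_path.simps)
  ultimately show ?thesis
    using moebius_geodesic_path[of s f \<gamma> t] assms(1) root_geodesic_act_bqf[OF assms(1,2) sf]
    by (auto simp: geodesic_points_def simp del: geodesic_path.simps)
qed

lemma translates_root_geodesic:
  assumes "indefinite q"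
  shows "(\<lambda>\<gamma>. translate_geodesic \<gamma> (root_geodesic q)) ` SL2Z = root_geodesic ` {q'. bqf_equiv q q'}"
proof -
  have *: "translate_geodesic \<gamma> (root_geodesic q) = root_geodesic (act_bqf (sl2_inv \<gamma>) q)"
    if "\<gamma> \<in> SL2Z" for \<gamma>
    using root_geodesic_act_bqf(1)[of \<gamma> "act_bqf (sl2_inv \<gamma>) q"] that assms
    by (cases "root_geodesic q") simp
  show ?thesis
  proof (intro equalityI subsetI)
    fix g assume "g \<in> (\<lambda>\<gamma>. translate_geodesic \<gamma> (root_geodesic q)) ` SL2Z"
    thus "g \<in> root_geodesic ` {q'. bqf_equiv q q'}"
      by (auto simp: * bqf_equiv_refl bqf_equiv_act_bqf)
  next
    fix g assume "g \<in> root_geodesic ` {q'. bqf_equiv q q'}"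
    then obtain \<gamma> where \<gamma>: "\<gamma> \<in> SL2Z" "g = root_geodesic (act_bqf \<gamma> q)"
      by (auto simp: bqf_equiv_def)
    hence "g = translate_geodesic (sl2_inv \<gamma>) (root_geodesic q)" by (simp add: *)
    thus "g \<in> (\<lambda>\<gamma>. translate_geodesic \<gamma> (root_geodesic q)) ` SL2Z" using \<gamma> by auto
  qed
qed

section \<open>Stabilizers and finiteness\<close>

text \<open>Converse of \<open>stabilizer_form\<close>: under these relations each coefficient is
  multiplied by the determinant.\<close>

lemma act_bqf_stabilizer:
  assumes "\<gamma> \<in> SL2Z" "\<gamma>$2$1 = A * u" "\<gamma>$2$2 - \<gamma>$1$1 = B * u" "\<gamma>$1$2 = - C * u"
  shows "act_bqf \<gamma> (A, B, C) = (A, B, C)"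
proof -
  define a where "a = \<gamma>$1$1"
  have e: "\<gamma>$1$1 = a" "\<gamma>$2$2 = a + B * u" "\<gamma>$2$1 = A * u" "\<gamma>$1$2 = - C * u"
    using assms by (simp_all add: a_def)
  have det: "a * (a + B * u) + A * C * u^2 = 1"
    using assms(1) by (simp add: SL2Z_iff e power2_eq_square algebra_simps)
  have "A * a^2 + B * a * (A * u) + C * (A * u)^2 = A * (a * (a + B * u) + A * C * u^2)"
    "2 * A * a * (- C * u) + B * (a * (a + B * u) + (- C * u) * (A * u)) + 2 * C * (A * u) * (a + B * u)
       = B * (a * (a + B * u) + A * C * u^2)"
    "A * (- C * u)^2 + B * (- C * u) * (a + B * u) + C * (a + B * u)^2
       = C * (a * (a + B * u) + A * C * u^2)"
    by (simp_all add: power2_eq_square algebra_simps)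
  thus ?thesis unfolding det by (simp only: act_bqf.simps Let_def e mult_1_right)
qed

text \<open>(f, 1) and (s, 1) are eigenvectors of \<gamma>, and the denominators c f + d and c s + d
  are the eigenvalues (t + u R) / 2 and (t - u R) / 2. Their product is 1, so the quotient that
  governs the shift is the square of the first. The square also absorbs the sign of
  \<gamma>.\<close>

lemma stabilizer_translation:
  fixes u :: int and q :: bqf
  assumes \<gamma>: "\<gamma> \<in> SL2Z" and q: "q = (A, B, C)" "indefinite q"
    and u: "\<gamma>$2$1 = A * u" "\<gamma>$2$2 - \<gamma>$1$1 = B * u" "\<gamma>$1$2 = - C * u"
    and t: "t = \<gamma>$1$1 + \<gamma>$2$2"
  shows "t^2 - disc q * u^2 = 4"
    "moebius \<gamma> (geodesic_path (root_geodesic q) x) =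
      geodesic_path (root_geodesic q) (x + ln ((t + u * sqrt (disc q))^2 / 4))"
proof -
  have "t^2 - disc q * u^2 = t^2 - (B * u)^2 + 4 * (A * u) * (C * u)"
    by (simp add: q power2_eq_square algebra_simps)
  also have "\<dots> = t^2 - (\<gamma>$2$2 - \<gamma>$1$1)^2 - 4 * \<gamma>$2$1 * \<gamma>$1$2" using u by simp
  also have "\<dots> = 4 * (\<gamma>$1$1 * \<gamma>$2$2 - \<gamma>$1$2 * \<gamma>$2$1)"
    by (simp add: t power2_eq_square algebra_simps)
  finally show norm: "t^2 - disc q * u^2 = 4" using \<gamma> by (simp add: SL2Z_iff)
  define R where "R = sqrt (disc q)"
  have "disc q > 0" using q by (simp add: indefinite_def)
  hence R: "R^2 = disc q" by (simp add: R_def)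
  obtain s f where sf: "root_geodesic q = (s, f)" by (cases "root_geodesic q")
  have st: "act_bqf \<gamma> q = q" unfolding q(1) by (rule act_bqf_stabilizer[OF \<gamma> u])
  note tr = root_geodesic_act_bqf[OF \<gamma> q(2), unfolded st, OF sf]
  have A: "A \<noteq> 0" using q indefinite_fst_nonzero by blast
  have "s \<noteq> f" using root_geodesic_endpoints(3) q sf by blast
  note m = moebius_geodesic_path[OF this \<gamma> tr(2,3), of x]
  have d: "2 * \<gamma>$2$2 = t + B * u" using u(2) t by simp
  have sf': "s = (- real_of_int B - R) / (2 * real_of_int A)" "f = (- real_of_int B + R) / (2 * real_of_int A)"
    using sf by (simp_all add: root_geodesic_def q R_def)
  have "2 * real_of_int (\<gamma>$2$2) = of_int (t + B * u)" unfolding d[symmetric] by simp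
  hence d': "real_of_int (\<gamma>$2$2) = (t + B * u) / 2" by simp
  have cf: "\<gamma>$2$1 * f + \<gamma>$2$2 = (t + u * R) / 2" and cs: "\<gamma>$2$1 * s + \<gamma>$2$2 = (t - u * R) / 2"
    unfolding d' sf' u(1) using A by (simp_all add: field_simps)
  have "real_of_int (t^2 - disc q * u^2) = 4" unfolding norm by simp
  hence "(t + u * R) * (t - u * R) = 4" by (simp add: algebra_simps power2_eq_square flip: R)
  moreover from this have "t - u * R \<noteq> 0" by auto
  ultimately have "4 / (t - u * R) = t + u * R" by (simp add: nonzero_divide_eq_eq)
  moreover have "(P / 2) / (Q / 2) = P * (4 / Q) / 4" for P Q :: real by simp
  ultimately have ratio: "((t + u * R) / 2) / ((t - u * R) / 2) = (t + u * R)^2 / 4"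
    by (simp only: power2_eq_square)
  have shift: "\<bar>(\<gamma>$2$1 * f + \<gamma>$2$2) / (\<gamma>$2$1 * s + \<gamma>$2$2)\<bar> = (t + u * R)^2 / 4"
    unfolding cf cs ratio by simp
  show "moebius \<gamma> (geodesic_path (root_geodesic q) x) =
      geodesic_path (root_geodesic q) (x + ln ((t + u * sqrt (disc q))^2 / 4))"
    using m unfolding sf tr(1)[symmetric] R_def[symmetric] shift .
qed

section \<open>The translation length of the automorph\<close>

lemma ln_unit_conjugate:
  fixes t u D :: int
  assumes "t^2 - D * u^2 = 4" "D > 0"
  shows "ln ((t - u * sqrt D)^2 / 4) = - ln ((t + u * sqrt D)^2 / 4)"
proof -
  have "real_of_int (t^2 - D * u^2) = 4" unfolding assms(1) by simp
  moreover have "(sqrt D)^2 = real_of_int D" using assms(2) by simp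
  ultimately have p: "(t + u * sqrt D) * (t - u * sqrt D) = 4"
    by (simp add: algebra_simps power2_eq_square)
  hence ne: "t + u * sqrt D \<noteq> 0" "t - u * sqrt D \<noteq> 0" by auto
  have "((t + u * sqrt D)^2 / 4) * ((t - u * sqrt D)^2 / 4) = ((t + u * sqrt D) * (t - u * sqrt D))^2 / 16"
    by (simp add: power_mult_distrib)
  hence "((t + u * sqrt D)^2 / 4) * ((t - u * sqrt D)^2 / 4) = 1" unfolding p by simp
  hence "ln ((t + u * sqrt D)^2 / 4) + ln ((t - u * sqrt D)^2 / 4) = 0"
    using ne by (subst ln_mult_pos[symmetric]) auto
  thus ?thesis by simp
qed

text \<open>Twice the logarithm of the unit (T + U sqrt D) / 2, which is the hyperbolic length of
  the closed geodesic of \<open>q\<close>.\<close>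

definition translation_length :: "bqf \<Rightarrow> real" where
  "translation_length q =
    (case smallest_pell4 (disc q) of (T, U) \<Rightarrow> ln ((T + U * sqrt (disc q))^2 / 4))"

lemma automorph_SL2Z:
  assumes "indefinite (A, B, C)" "smallest_pell4 (disc (A, B, C)) = (T, U)"
  defines "\<gamma> \<equiv> automorph (A, B, C)"
  shows "\<gamma> \<in> SL2Z" "\<gamma>$2$1 = A * U" "\<gamma>$2$2 - \<gamma>$1$1 = B * U" "\<gamma>$1$2 = - C * U" "\<gamma>$1$1 + \<gamma>$2$2 = T"
proof -
  have "pell4 (disc (A, B, C)) T U"
    using smallest_pell4[of "disc (A, B, C)"] assms(1,2) unfolding indefinite_def
    by (metis prod.inject)
  hence pell: "T^2 - (B^2 - 4 * A * C) * U^2 = 4" by (simp add: pell4_def)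
  \<comment> \<open>As D is B^2 modulo 4, T and B U have the same parity, so \<open>div 2\<close> in
    \<open>automorph\<close> is exact.\<close>
  hence "T^2 = (B * U)^2 + 2 * (2 - 2 * A * C * U^2)" by (simp add: power2_eq_square algebra_simps)
  hence "even (T^2) \<longleftrightarrow> even ((B * U)^2)" by presburger
  hence "even (T - B * U)" by simp
  then obtain a where a: "T - B * U = 2 * a" ..
  hence T: "T = 2 * a + B * U" by simp
  have \<gamma>: "\<gamma>$1$1 = a" "\<gamma>$1$2 = - C * U" "\<gamma>$2$1 = A * U" "\<gamma>$2$2 = a + B * U"
    using assms(2) by (simp_all add: \<gamma>_def T)
  show "\<gamma>$2$1 = A * U" "\<gamma>$2$2 - \<gamma>$1$1 = B * U" "\<gamma>$1$2 = - C * U" "\<gamma>$1$1 + \<gamma>$2$2 = T"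
    by (simp_all add: \<gamma> T)
  have "4 * (a * (a + B * U) + A * C * U^2) = 4"
    using pell unfolding T by (simp add: power2_eq_square algebra_simps)
  thus "\<gamma> \<in> SL2Z" by (simp add: SL2Z_iff \<gamma> power2_eq_square algebra_simps)
qed

lemma translation_length_pos:
  assumes "indefinite q"
  shows "translation_length q > 0"
proof -
  have D: "disc q > 0" "\<nexists>k. disc q = k^2" using assms by (auto simp: indefinite_def)
  obtain T U where TU: "smallest_pell4 (disc q) = (T, U)" "pell4 (disc q) T U"
    using smallest_pell4[OF D] by metis
  have p: "T > 0" "U > 0" "T^2 = 4 + disc q * U^2" using TU(2) by (auto simp: pell4_def)
  have "disc q * U^2 > 0" using D p by simp
  hence "2^2 < T^2" using p by simp
  hence "T > 2" by (rule power_less_imp_less_base) (use p in simp)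
  moreover have "real_of_int U * sqrt (disc q) > 0" using p D by simp
  ultimately have "2 < T + U * sqrt (disc q)" by linarith
  hence "2^2 < (T + U * sqrt (disc q))^2" by (intro power_strict_mono) auto
  thus ?thesis by (simp add: translation_length_def TU ln_gt_zero)
qed

lemma automorph_translation:
  assumes "indefinite q"
  shows "automorph q \<in> SL2Z" "act_bqf (automorph q) q = q"
    "moebius (automorph q) (geodesic_path (root_geodesic q) x) =
      geodesic_path (root_geodesic q) (x + translation_length q)"
    "moebius (sl2_inv (automorph q)) (geodesic_path (root_geodesic q) x) =
      geodesic_path (root_geodesic q) (x - translation_length q)"
proof -
  obtain A B C where q: "q = (A, B, C)" by (cases q)
  obtain T U where TU: "smallest_pell4 (disc q) = (T, U)" by (cases "smallest_pell4 (disc q)")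
  note a = automorph_SL2Z[OF assms[unfolded q] TU[unfolded q], folded q]
  show "automorph q \<in> SL2Z" by (rule a(1))
  show "act_bqf (automorph q) q = q" using act_bqf_stabilizer[OF a(1-4)] q by simp
  note tr = stabilizer_translation[OF a(1) q assms a(2-4) a(5)[symmetric]]
  show "moebius (automorph q) (geodesic_path (root_geodesic q) x) =
      geodesic_path (root_geodesic q) (x + translation_length q)"
    using tr(2) by (simp only: translation_length_def TU prod.case)
  \<comment> \<open>The inverse has the same trace and the factor -U, so its shift belongs to the
    conjugate unit and is the negative one.\<close>
  have i: "sl2_inv (automorph q) $ 2 $ 1 = A * (- U)"
    "sl2_inv (automorph q) $ 2 $ 2 - sl2_inv (automorph q) $ 1 $ 1 = B * (- U)"
    "sl2_inv (automorph q) $ 1 $ 2 = - C * (- U)"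
    "T = sl2_inv (automorph q) $ 1 $ 1 + sl2_inv (automorph q) $ 2 $ 2"
    using a by simp_all
  have "disc q > 0" using assms by (simp add: indefinite_def)
  note ln_unit_conjugate[OF tr(1) this]
  moreover note stabilizer_translation(2)[OF sl2_inv_SL2Z[OF a(1)] q assms i, of x]
  ultimately show "moebius (sl2_inv (automorph q)) (geodesic_path (root_geodesic q) x) =
      geodesic_path (root_geodesic q) (x - translation_length q)"
    by (simp add: translation_length_def TU del: geodesic_path.simps)
qed

text \<open>If u is nonzero, (|t|, |u|) is a Pell solution, hence at least (T, U) in both
  coordinates, and the shift is at least the translation length. A shorter shift forces u = 0, so
  \<gamma> is 1 or -1 and fixes every form.\<close>

lemma stabilizer_short_translation:
  assumes "PIBQF q" "\<gamma> \<in> SL2Z" "act_bqf \<gamma> q = q"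
  obtains \<sigma> where
    "\<And>x. moebius \<gamma> (geodesic_path (root_geodesic q) x) = geodesic_path (root_geodesic q) (x + \<sigma>)"
    "\<And>p. \<bar>\<sigma>\<bar> < translation_length q \<Longrightarrow> act_bqf \<gamma> p = p"
proof -
  obtain A B C where q: "q = (A, B, C)" by (cases q)
  have ind: "indefinite q" using assms(1) by (rule PIBQF_indefinite)
  hence D: "disc q > 0" "\<nexists>k. disc q = k^2" by (auto simp: indefinite_def)
  have "A \<noteq> 0" using ind q indefinite_fst_nonzero by blast
  moreover have "gcd A (gcd B C) = 1" using assms(1) by (simp add: q)
  ultimately obtain u where u: "\<gamma>$2$1 = A * u" "\<gamma>$2$2 - \<gamma>$1$1 = B * u" "\<gamma>$1$2 = - C * u"
    by (rule stabilizer_form[OF assms(2) assms(3)[unfolded q]])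
  define t where "t = \<gamma>$1$1 + \<gamma>$2$2"
  define R where "R = sqrt (disc q)"
  have R: "R > 0" using D by (simp add: R_def)
  note tr = stabilizer_translation[OF assms(2) q ind u t_def, folded R_def]
  obtain T U where TU: "smallest_pell4 (disc q) = (T, U)" "pell4 (disc q) T U"
    "\<And>t u. pell4 (disc q) t u \<Longrightarrow> T \<le> t \<and> U \<le> u"
    using smallest_pell4[OF D] by metis
  define \<sigma> where "\<sigma> = ln ((t + u * R)^2 / 4)"
  have "act_bqf \<gamma> p = p" if small: "\<bar>\<sigma>\<bar> < translation_length q" for p
  proof -
    have "u = 0"
    proof (rule ccontr)
      assume "u \<noteq> 0"
      moreover have "t \<noteq> 0"
      proof
        assume "t = 0"
        hence "disc q * u^2 = - 4" using tr(1) by simp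
        moreover have "disc q * u^2 \<ge> 0" using D by simp
        ultimately show False by linarith
      qed
      ultimately have "pell4 (disc q) \<bar>t\<bar> \<bar>u\<bar>" using tr(1) by (simp add: pell4_def)
      hence le: "T \<le> \<bar>t\<bar>" "U \<le> \<bar>u\<bar>" using TU(3) by blast+
      have p: "T > 0" "U > 0" using TU(2) by (auto simp: pell4_def)
      \<comment> \<open>v^2 is (t + u R)^2 or (t - u R)^2 according to the sign of t u. These two
        give opposite logarithms, so ln (v^2 / 4) is \<sigma> or -\<sigma>.\<close>
      define v where "v = \<bar>real_of_int t\<bar> + \<bar>real_of_int u\<bar> * R"
      have "real_of_int T \<le> \<bar>real_of_int t\<bar>" "real_of_int U \<le> \<bar>real_of_int u\<bar>" using le by linarith+
      hence "T + U * R \<le> v" unfolding v_def using R by (intro add_mono mult_right_mono) auto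
      moreover have TUR: "T + U * R > 0" using p R by (simp add: add_pos_pos)
      ultimately have "(T + U * R)^2 / 4 \<le> v^2 / 4" by (intro divide_right_mono power_mono) auto
      hence "ln ((T + U * R)^2 / 4) \<le> ln (v^2 / 4)"
        using TUR by (intro ln_mono) auto
      hence le: "translation_length q \<le> ln (v^2 / 4)"
        by (simp add: translation_length_def TU(1) R_def)
      have "ln (v^2 / 4) \<le> \<bar>\<sigma>\<bar>"
      proof (cases "t * u \<ge> 0")
        case True
        hence "\<bar>real_of_int t\<bar> * \<bar>real_of_int u\<bar> = t * u"
          by (simp flip: abs_mult of_int_mult of_int_abs)
        hence "v^2 = (t + u * R)^2" by (simp add: v_def power2_eq_square algebra_simps)
        thus ?thesis by (simp add: \<sigma>_def)
      next
        case False
        hence "\<bar>real_of_int t\<bar> * \<bar>real_of_int u\<bar> = - (t * u)"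
          by (simp flip: abs_mult of_int_mult of_int_abs)
        hence "v^2 = (t - u * R)^2" by (simp add: v_def power2_eq_square algebra_simps)
        hence "ln (v^2 / 4) = - \<sigma>"
          using ln_unit_conjugate[OF tr(1) D(1)] by (simp add: \<sigma>_def R_def)
        thus ?thesis by simp
      qed
      thus False using le small by simp
    qed
    hence e: "\<gamma>$2$1 = 0" "\<gamma>$1$2 = 0" "\<gamma>$2$2 = \<gamma>$1$1" using u by auto
    hence "(\<gamma>$1$1)^2 = 1" using assms(2) by (simp add: SL2Z_iff power2_eq_square)
    thus ?thesis by (cases p) (simp add: e Let_def power2_eq_square)
  qed
  thus ?thesis using that[of \<sigma>] tr(2) unfolding \<sigma>_def by blast
qed

text \<open>This moves the crossing of \<open>p\<close> with the geodesic of \<open>q\<close> by any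
  integer multiple of the translation length, while \<open>q\<close> stays fixed. The matrix
  \<delta> is a power of the automorph, built up in both directions.\<close>

lemma automorph_translates:
  assumes "indefinite q" "geodesic_path (root_geodesic q) t \<in> geodesic_points (root_geodesic p)"
    and "indefinite p"
  shows "\<exists>\<delta>\<in>SL2Z. act_bqf \<delta> q = q \<and>
    geodesic_path (root_geodesic q) (t + of_int n * translation_length q) \<in>
      geodesic_points (root_geodesic (act_bqf \<delta> p))"
proof (induction n rule: int_induct[of _ 0])
  case base
  show ?case using assms(2) by (intro bexI[of _ "mat 1"]) (simp_all del: act_bqf.simps)
next
  case (step1 i)
  then obtain \<delta> where \<delta>: "\<delta> \<in> SL2Z" "act_bqf \<delta> q = q"
    "geodesic_path (root_geodesic q) (t + of_int i * translation_length q) \<in>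
      geodesic_points (root_geodesic (act_bqf \<delta> p))" by blast
  define \<epsilon> where "\<epsilon> = sl2_inv (automorph q)"
  note a = automorph_translation[OF assms(1)]
  have \<epsilon>: "\<epsilon> \<in> SL2Z" "act_bqf \<epsilon> q = q"
    using a(1) act_bqf_inv(1)[OF a(1), of q] by (simp_all add: \<epsilon>_def a(2))
  \<comment> \<open>A shift forward needs the inverse automorph on forms: the current form is the
    automorph applied to the next one, and \<open>moebius\<close> of the automorph leads from the
    former's geodesic to the latter's.\<close>
  have "geodesic_path (root_geodesic q) (t + of_int i * translation_length q) \<in>
      geodesic_points (root_geodesic (act_bqf (automorph q) (act_bqf (\<delta> ** \<epsilon>) p)))"
    using \<delta>(3) a(1) by (simp add: \<epsilon>_def act_bqf_mult)
  from moebius_geodesic_points[OF a(1) _ this]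
  have "geodesic_path (root_geodesic q) (t + of_int (i + 1) * translation_length q) \<in>
      geodesic_points (root_geodesic (act_bqf (\<delta> ** \<epsilon>) p))"
    using assms(3) \<delta>(1) \<epsilon>(1) by (simp add: a(3) distrib_right add.assoc)
  thus ?case using \<delta>(1,2) \<epsilon> by (intro bexI[of _ "\<delta> ** \<epsilon>"]) (simp_all add: act_bqf_mult)
next
  case (step2 i)
  then obtain \<delta> where \<delta>: "\<delta> \<in> SL2Z" "act_bqf \<delta> q = q"
    "geodesic_path (root_geodesic q) (t + of_int i * translation_length q) \<in>
      geodesic_points (root_geodesic (act_bqf \<delta> p))" by blast
  define \<epsilon> where "\<epsilon> = automorph q"
  note a = automorph_translation[OF assms(1), folded \<epsilon>_def]
  have "geodesic_path (root_geodesic q) (t + of_int i * translation_length q) \<in>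
      geodesic_points (root_geodesic (act_bqf (sl2_inv \<epsilon>) (act_bqf (\<delta> ** \<epsilon>) p)))"
    using \<delta>(3) a(1) by (simp add: act_bqf_mult)
  from moebius_geodesic_points[OF sl2_inv_SL2Z[OF a(1)] _ this]
  have "geodesic_path (root_geodesic q) (t + of_int (i - 1) * translation_length q) \<in>
      geodesic_points (root_geodesic (act_bqf (\<delta> ** \<epsilon>) p))"
    using assms(3) \<delta>(1) a(1) by (simp add: a(4) left_diff_distrib add_diff_eq)
  thus ?case using \<delta>(1,2) a(1,2) by (intro bexI[of _ "\<delta> ** \<epsilon>"]) (simp_all add: act_bqf_mult)
qed

text \<open>For z = x + i y on the geodesic, (2 A x + B)^2 + (2 A y)^2 = D. The lower bound on y
  bounds A, then the bound on x bounds B, and the discriminant bounds C because A is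
  nonzero.\<close>

lemma finite_forms_near:
  fixes \<epsilon> M :: real
  assumes "\<epsilon> > 0"
  shows "finite {p. indefinite p \<and> disc p = D \<and>
    (\<exists>z\<in>geodesic_points (root_geodesic p). Im z \<ge> \<epsilon> \<and> \<bar>Re z\<bar> \<le> M)}" (is "finite ?F")
proof -
  define R where "R = sqrt D"
  define a where "a = R / (2 * \<epsilon>)"
  define b where "b = R + 2 * a * M"
  define N where "N = \<lceil>max a b\<rceil>"
  have "?F \<subseteq> {-N..N} \<times> {-N..N} \<times> {-(N^2 + D)..N^2 + D}"
  proof
    fix p assume "p \<in> ?F"
    then obtain z where z: "indefinite p" "disc p = D" "z \<in> geodesic_points (root_geodesic p)"
      "Im z \<ge> \<epsilon>" "\<bar>Re z\<bar> \<le> M" by auto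
    obtain A B C where p: "p = (A, B, C)" by (cases p)
    define x y where "x = Re z" and "y = Im z"
    have A: "A \<noteq> 0" using z(1) indefinite_fst_nonzero p by blast
    have D: "D > 0" using z by (simp add: indefinite_def)
    have DA: "D = B^2 - 4 * A * C" using z(2) p by simp
    have "A * (x^2 + y^2) + B * x + C = 0"
      using z(3) geodesic_points_root_geodesic[of A B C] z(1) by (simp add: p x_def y_def)
    moreover have "(2 * A * x + B)^2 + (2 * A * y)^2
        = 4 * A * (A * (x^2 + y^2) + B * x + C) + (B^2 - 4 * A * C)"
      by (simp add: power2_eq_square algebra_simps)
    ultimately have eq: "(2 * A * x + B)^2 + (2 * A * y)^2 = D" by (simp add: DA)
    have "R \<ge> 0" "R^2 = D" using D by (auto simp: R_def)
    moreover from this have "(2 * A * x + B)^2 \<le> R^2" "(2 * A * y)^2 \<le> R^2"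
      using eq zero_le_power2[of "2 * A * x + B"] zero_le_power2[of "2 * A * y"] by linarith+
    ultimately have 1: "\<bar>2 * A * x + B\<bar> \<le> R" and 2: "\<bar>2 * A * y\<bar> \<le> R"
      by (metis abs_le_square_iff abs_of_nonneg)+
    have "2 * \<bar>real_of_int A\<bar> * \<epsilon> \<le> 2 * \<bar>real_of_int A\<bar> * y"
      using z(4) by (intro mult_left_mono) (auto simp: y_def)
    also have "\<dots> \<le> R" using 2 z(4) assms by (simp add: abs_mult y_def)
    finally have Aa: "\<bar>real_of_int A\<bar> \<le> a" using assms by (simp add: a_def field_simps)
    have "\<bar>2 * A * x\<bar> = 2 * (\<bar>real_of_int A\<bar> * \<bar>x\<bar>)" by (simp add: abs_mult)
    also have "\<dots> \<le> 2 * (a * M)" using Aa z(5) by (intro mult_left_mono mult_mono) (auto simp: x_def)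
    finally have Bb: "\<bar>real_of_int B\<bar> \<le> b" using 1 unfolding b_def by linarith
    have AN: "\<bar>A\<bar> \<le> N" and BN: "\<bar>B\<bar> \<le> N" using Aa Bb unfolding N_def by linarith+
    have "1 * \<bar>C\<bar> \<le> 4 * \<bar>A\<bar> * \<bar>C\<bar>" using A by (intro mult_right_mono) auto
    hence "\<bar>C\<bar> \<le> \<bar>4 * A * C\<bar>" by (simp add: abs_mult)
    also have "4 * A * C = B^2 - D" using DA by simp
    also have "\<bar>B^2 - D\<bar> \<le> B^2 + D" using D zero_le_power2[of B] by linarith
    also have "B^2 \<le> N^2" using BN by (metis abs_ge_zero power2_abs power_mono)
    finally have "\<bar>C\<bar> \<le> N^2 + D" by simp
    thus "p \<in> {-N..N} \<times> {-N..N} \<times> {-(N^2 + D)..N^2 + D}" using AN BN by (auto simp: p)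
  qed
  thus ?thesis by (rule finite_subset) simp
qed

lemma geodesic_segment_bounded:
  fixes s f t\<^sub>0 t\<^sub>1 :: real
  assumes "s \<noteq> f"
  obtains \<epsilon> M where "\<epsilon> > 0"
    "\<And>t. t \<in> {t\<^sub>0..t\<^sub>1} \<Longrightarrow> Im (geodesic_path (s, f) t) \<ge> \<epsilon> \<and> \<bar>Re (geodesic_path (s, f) t)\<bar> \<le> M"
proof
  \<comment> \<open>|t| is at most m on the segment, so cosh t is at most exp m.\<close>
  define m where "m = \<bar>t\<^sub>0\<bar> + \<bar>t\<^sub>1\<bar>"
  show "\<bar>f - s\<bar> / (2 * exp m) > 0" using assms by simp
  fix t assume t: "t \<in> {t\<^sub>0..t\<^sub>1}"
  have "exp t \<le> exp m" "exp (- t) \<le> exp m" using t by (auto simp: m_def)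
  from add_mono[OF this] have "cosh t \<le> exp m" by (simp add: cosh_field_def)
  hence 1: "Im (geodesic_path (s, f) t) \<ge> \<bar>f - s\<bar> / (2 * exp m)"
    by (simp add: frac_le)
  have "\<bar>tanh t\<bar> \<le> 1" using tanh_real_bounds[of t] by auto
  hence "\<bar>(f - s) / 2\<bar> * \<bar>tanh t\<bar> \<le> \<bar>(f - s) / 2\<bar> * 1" by (intro mult_left_mono) auto
  hence "\<bar>(f - s) / 2 * tanh t\<bar> \<le> \<bar>(f - s) / 2\<bar>" by (simp add: abs_mult)
  hence "\<bar>Re (geodesic_path (s, f) t)\<bar> \<le> \<bar>(s + f) / 2\<bar> + \<bar>(f - s) / 2\<bar>"
    unfolding geodesic_path.simps complex.sel by linarith
  thus "Im (geodesic_path (s, f) t) \<ge> \<bar>f - s\<bar> / (2 * exp m) \<and>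
    \<bar>Re (geodesic_path (s, f) t)\<bar> \<le> \<bar>(s + f) / 2\<bar> + \<bar>(f - s) / 2\<bar>" using 1 by blast
qed

section \<open>Intersection numbers\<close>

text \<open>The common index set of both counts: the forms equivalent to \<open>q\<^sub>1\<close>
  that cross the geodesic of \<open>q\<^sub>2\<close> within one period. Transversality is encoded
  by the invariant inequality.\<close>

definition meets_segment :: "bqf \<Rightarrow> bqf \<Rightarrow> real \<Rightarrow> bqf set" where
  "meets_segment q\<^sub>1 q\<^sub>2 t\<^sub>0 = {p. bqf_equiv q\<^sub>1 p \<and>
    \<bar>real_of_int (B_Delta p q\<^sub>2)\<bar> < sqrt (of_int (disc p * disc q\<^sub>2)) \<and>
    (\<exists>t\<in>{t\<^sub>0..<t\<^sub>0 + translation_length q\<^sub>2}.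
      geodesic_path (root_geodesic q\<^sub>2) t \<in> geodesic_points (root_geodesic p))}"

lemma card_transverse_points_root_geodesic:
  assumes "indefinite q" "indefinite q'"
  shows "card (transverse_points (root_geodesic q) (root_geodesic q')) = 1 \<longleftrightarrow>
    \<bar>real_of_int (B_Delta q q')\<bar> < sqrt (of_int (disc q * disc q'))"
  using transverse_points_root_geodesic[OF assms] by (auto split: if_splits)

lemma root_geodesic_path_inj:
  assumes "indefinite q"
  shows "geodesic_path (root_geodesic q) t = geodesic_path (root_geodesic q) u \<longleftrightarrow> t = u"
proof -
  obtain A B C where q: "q = (A, B, C)" by (cases q)
  obtain s f where sf: "root_geodesic q = (s, f)" by (cases "root_geodesic q")
  show ?thesis using geodesic_path_inj[OF root_geodesic_endpoints(3)] assms q sf by metis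
qed

lemma root_geodesic_segment:
  fixes t\<^sub>0 :: real
  assumes "indefinite q"
  defines "z \<equiv> geodesic_path (root_geodesic q) t\<^sub>0"
  shows "half_open_segment (root_geodesic q) z (moebius (automorph q) z) =
    geodesic_path (root_geodesic q) ` {t\<^sub>0..<t\<^sub>0 + translation_length q}"
proof -
  obtain A B C where q: "q = (A, B, C)" by (cases q)
  obtain s f where sf: "root_geodesic q = (s, f)" by (cases "root_geodesic q")
  have "s \<noteq> f" using root_geodesic_endpoints(3) assms(1) q sf by blast
  thus ?thesis unfolding z_def automorph_translation(3)[OF assms(1)] unfolding sf
    using translation_length_pos[OF assms(1)] by (intro half_open_segment_eq) auto
qed

lemma finite_meets_segment:
  assumes "indefinite q\<^sub>1" "indefinite q\<^sub>2"
  shows "finite (meets_segment q\<^sub>1 q\<^sub>2 t\<^sub>0)"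
proof -
  obtain A B C where q: "q\<^sub>2 = (A, B, C)" by (cases q\<^sub>2)
  obtain s f where sf: "root_geodesic q\<^sub>2 = (s, f)" by (cases "root_geodesic q\<^sub>2")
  have "s \<noteq> f" using root_geodesic_endpoints(3) assms(2) q sf by blast
  then obtain \<epsilon> M where b: "\<epsilon> > 0" "\<And>t. t \<in> {t\<^sub>0..t\<^sub>0 + translation_length q\<^sub>2} \<Longrightarrow>
      Im (geodesic_path (s, f) t) \<ge> \<epsilon> \<and> \<bar>Re (geodesic_path (s, f) t)\<bar> \<le> M"
    using geodesic_segment_bounded by metis
  have "meets_segment q\<^sub>1 q\<^sub>2 t\<^sub>0 \<subseteq> {p. indefinite p \<and> disc p = disc q\<^sub>1 \<and>
    (\<exists>z\<in>geodesic_points (root_geodesic p). Im z \<ge> \<epsilon> \<and> \<bar>Re z\<bar> \<le> M)}"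
  proof
    fix p assume "p \<in> meets_segment q\<^sub>1 q\<^sub>2 t\<^sub>0"
    then obtain t where t: "bqf_equiv q\<^sub>1 p" "t \<in> {t\<^sub>0..<t\<^sub>0 + translation_length q\<^sub>2}"
      "geodesic_path (s, f) t \<in> geodesic_points (root_geodesic p)"
      unfolding meets_segment_def sf by blast
    have "t \<in> {t\<^sub>0..t\<^sub>0 + translation_length q\<^sub>2}" using t(2) by simp
    from b(2)[OF this] t(1,3) bqf_equiv_disc[OF t(1)] bqf_equiv_indefinite[OF t(1) assms(1)]
    show "p \<in> {p. indefinite p \<and> disc p = disc q\<^sub>1 \<and>
      (\<exists>z\<in>geodesic_points (root_geodesic p). Im z \<ge> \<epsilon> \<and> \<bar>Re z\<bar> \<le> M)}" by blast
  qed
  thus ?thesis using finite_forms_near[OF b(1)] by (rule finite_subset)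
qed

text \<open>All forms involved have the discriminant of \<open>q\<^sub>1\<close>, so the geodesic
  determines the form, and the form determines the single crossing point.\<close>

lemma lifted_intersections_bij:
  assumes "indefinite q\<^sub>1" "indefinite q\<^sub>2"
  shows "bij_betw (\<lambda>p. (root_geodesic p, the_elem (transverse_points (root_geodesic p) (root_geodesic q\<^sub>2))))
    (meets_segment q\<^sub>1 q\<^sub>2 t\<^sub>0)
    (lifted_intersections q\<^sub>1 q\<^sub>2 (geodesic_path (root_geodesic q\<^sub>2) t\<^sub>0))"
    (is "bij_betw ?h ?S (lifted_intersections q\<^sub>1 q\<^sub>2 ?z)")
proof (rule bij_betw_imageI)
  have equiv: "indefinite p \<and> disc p = disc q\<^sub>1" if "bqf_equiv q\<^sub>1 p" for p
    using that bqf_equiv_disc bqf_equiv_indefinite assms(1) by blast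
  show "inj_on ?h ?S"
    by (rule inj_onI) (metis (no_types, lifting) root_geodesic_inj equiv meets_segment_def
        mem_Collect_eq prod.inject)
  show "?h ` ?S = lifted_intersections q\<^sub>1 q\<^sub>2 ?z"
  proof (intro equalityI subsetI)
    fix v assume "v \<in> ?h ` ?S"
    then obtain p t where p: "v = ?h p" "bqf_equiv q\<^sub>1 p"
      "\<bar>real_of_int (B_Delta p q\<^sub>2)\<bar> < sqrt (of_int (disc p * disc q\<^sub>2))"
      "t \<in> {t\<^sub>0..<t\<^sub>0 + translation_length q\<^sub>2}"
      "geodesic_path (root_geodesic q\<^sub>2) t \<in> geodesic_points (root_geodesic p)"
      unfolding meets_segment_def by blast
    then obtain P where P: "transverse_points (root_geodesic p) (root_geodesic q\<^sub>2) = {P}"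
      "geodesic_points (root_geodesic p) \<inter> geodesic_points (root_geodesic q\<^sub>2) = {P}"
      using transverse_points_root_geodesic[of p q\<^sub>2] equiv assms(2) by auto
    have "geodesic_path (root_geodesic q\<^sub>2) t = P"
      using P(2) p(5) by (auto simp: geodesic_points_def)
    thus "v \<in> lifted_intersections q\<^sub>1 q\<^sub>2 ?z"
      unfolding lifted_intersections_def translates_root_geodesic[OF assms(1)]
        root_geodesic_segment[OF assms(2)] using p(1,2,4) P(1) by auto
  next
    fix v assume "v \<in> lifted_intersections q\<^sub>1 q\<^sub>2 ?z"
    then obtain p P t where p: "v = (root_geodesic p, P)" "bqf_equiv q\<^sub>1 p"
      "P \<in> transverse_points (root_geodesic p) (root_geodesic q\<^sub>2)"
      "t \<in> {t\<^sub>0..<t\<^sub>0 + translation_length q\<^sub>2}" "P = geodesic_path (root_geodesic q\<^sub>2) t"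
      unfolding lifted_intersections_def translates_root_geodesic[OF assms(1)]
        root_geodesic_segment[OF assms(2)] by auto
    note tr = transverse_points_root_geodesic[of p q\<^sub>2]
    have c: "\<bar>real_of_int (B_Delta p q\<^sub>2)\<bar> < sqrt (of_int (disc p * disc q\<^sub>2))"
      using tr p(3) equiv[OF p(2)] assms(2) by (metis empty_iff)
    hence P: "transverse_points (root_geodesic p) (root_geodesic q\<^sub>2) = {P}"
      "P \<in> geodesic_points (root_geodesic p)"
      using tr p(3) equiv[OF p(2)] assms(2) by auto
    hence "p \<in> ?S" unfolding meets_segment_def using p c by blast
    moreover have "v = ?h p" by (simp add: p(1) P(1))
    ultimately show "v \<in> ?h ` ?S" by blast
  qed
qed

text \<open>Surjectivity: bring the second form to \<open>q\<^sub>2\<close>, then move the crossing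
  into the segment by powers of the automorph. Injectivity: a matrix relating two such pairs fixes
  \<open>q\<^sub>2\<close> and shifts by less than one period, so it acts trivially.\<close>

lemma intersecting_pairs_bij:
  assumes "PIBQF q\<^sub>1" "PIBQF q\<^sub>2"
  shows "bij_betw (\<lambda>p. simultaneous_equiv `` {(p, q\<^sub>2)}) (meets_segment q\<^sub>1 q\<^sub>2 t\<^sub>0)
    (intersecting_pairs q\<^sub>1 q\<^sub>2 // simultaneous_equiv)"
    (is "bij_betw ?h ?S ?Q")
proof (rule bij_betw_imageI)
  define path where "path = geodesic_path (root_geodesic q\<^sub>2)"
  define L where "L = translation_length q\<^sub>2"
  have ind: "indefinite q\<^sub>1" "indefinite q\<^sub>2" using assms PIBQF_indefinite by auto
  have equiv: "indefinite p" if "bqf_equiv q\<^sub>1 p" for p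
    using that bqf_equiv_indefinite ind(1) by blast
  have cls: "?h p = simultaneous_equiv `` {(a, b)} \<longleftrightarrow> ((p, q\<^sub>2), (a, b)) \<in> simultaneous_equiv" for p a b
    by (rule eq_equiv_class_iff[OF equiv_simultaneous_equiv]) auto
  have unique: "t = t'" if h: "bqf_equiv q\<^sub>1 p" "\<bar>real_of_int (B_Delta p q\<^sub>2)\<bar> < sqrt (of_int (disc p * disc q\<^sub>2))"
    "path t \<in> geodesic_points (root_geodesic p)" "path t' \<in> geodesic_points (root_geodesic p)" for p t t'
  proof -
    obtain P where "geodesic_points (root_geodesic p) \<inter> geodesic_points (root_geodesic q\<^sub>2) = {P}"
      using transverse_points_root_geodesic[OF equiv[OF h(1)] ind(2)] h(2) by auto
    hence "path t = P" "path t' = P"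
      using h(3,4) unfolding path_def geodesic_points_def by blast+
    thus ?thesis using root_geodesic_path_inj[OF ind(2), folded path_def] by metis
  qed
  show "inj_on ?h ?S"
  proof (rule inj_onI)
    fix p p' assume S: "p \<in> ?S" "p' \<in> ?S" and "?h p = ?h p'"
    then obtain \<gamma> where \<gamma>: "\<gamma> \<in> SL2Z" "act_bqf \<gamma> p = p'" "act_bqf \<gamma> q\<^sub>2 = q\<^sub>2"
      unfolding cls simultaneous_equiv_iff by blast
    obtain t where t: "t \<in> {t\<^sub>0..<t\<^sub>0 + L}" "path t \<in> geodesic_points (root_geodesic p)"
      using S(1) unfolding meets_segment_def path_def L_def by blast
    obtain t' where t': "t' \<in> {t\<^sub>0..<t\<^sub>0 + L}" "path t' \<in> geodesic_points (root_geodesic p')"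
      using S(2) unfolding meets_segment_def path_def L_def by blast
    have p: "bqf_equiv q\<^sub>1 p" "\<bar>real_of_int (B_Delta p q\<^sub>2)\<bar> < sqrt (of_int (disc p * disc q\<^sub>2))"
      using S(1) unfolding meets_segment_def by blast+
    obtain \<sigma> where \<sigma>: "\<And>x. moebius \<gamma> (path x) = path (x + \<sigma>)"
      "\<And>p. \<bar>\<sigma>\<bar> < L \<Longrightarrow> act_bqf \<gamma> p = p"
      using stabilizer_short_translation[OF assms(2) \<gamma>(1,3)] unfolding path_def L_def by metis
    \<comment> \<open>\<open>moebius \<gamma>\<close> carries the crossing of p' back to the
      geodesic of p, which has only the crossing at t.\<close>
    have "path (t' + \<sigma>) \<in> geodesic_points (root_geodesic p)"
      using moebius_geodesic_points[OF \<gamma>(1) equiv[OF p(1)]] t'(2) unfolding \<gamma>(2) \<sigma>(1)[symmetric] by blast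
    hence "t = t' + \<sigma>" using unique[OF p t(2)] by blast
    \<comment> \<open>The strict bound comes from the half-open interval; with both ends included
      the automorph itself could relate two forms.\<close>
    hence "\<bar>\<sigma>\<bar> < L" using t(1) t'(1) by (auto simp: abs_less_iff)
    thus "p = p'" using \<sigma>(2) \<gamma>(2) by metis
  qed
  show "?h ` ?S = ?Q"
  proof (intro equalityI subsetI)
    fix X assume "X \<in> ?h ` ?S"
    then obtain p where p: "X = ?h p" "bqf_equiv q\<^sub>1 p"
      "\<bar>real_of_int (B_Delta p q\<^sub>2)\<bar> < sqrt (of_int (disc p * disc q\<^sub>2))"
      unfolding meets_segment_def by blast
    hence "card (transverse_points (root_geodesic p) (root_geodesic q\<^sub>2)) = 1"
      using card_transverse_points_root_geodesic[OF equiv[OF p(2)] ind(2)] by blast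
    hence "(p, q\<^sub>2) \<in> intersecting_pairs q\<^sub>1 q\<^sub>2"
      unfolding intersecting_pairs_def using p(2) bqf_equiv_refl by blast
    thus "X \<in> ?Q" unfolding p(1) by (rule quotientI)
  next
    fix X assume "X \<in> ?Q"
    then obtain v where "X = simultaneous_equiv `` {v}" "v \<in> intersecting_pairs q\<^sub>1 q\<^sub>2"
      by (rule quotientE)
    then obtain p\<^sub>1 p\<^sub>2 where X: "X = simultaneous_equiv `` {(p\<^sub>1, p\<^sub>2)}"
      and "(p\<^sub>1, p\<^sub>2) \<in> intersecting_pairs q\<^sub>1 q\<^sub>2"
      by (cases v) simp
    hence p: "bqf_equiv q\<^sub>1 p\<^sub>1" "bqf_equiv q\<^sub>2 p\<^sub>2"
      "card (transverse_points (root_geodesic p\<^sub>1) (root_geodesic p\<^sub>2)) = 1"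
      unfolding intersecting_pairs_def by blast+
    have "indefinite p\<^sub>2" using bqf_equiv_indefinite[OF p(2) ind(2)] .
    hence c: "\<bar>real_of_int (B_Delta p\<^sub>1 p\<^sub>2)\<bar> < sqrt (of_int (disc p\<^sub>1 * disc p\<^sub>2))"
      using card_transverse_points_root_geodesic[OF equiv[OF p(1)]] p(3) by blast
    obtain \<delta> where \<delta>: "\<delta> \<in> SL2Z" "p\<^sub>2 = act_bqf \<delta> q\<^sub>2" using p(2) by (rule bqf_equivE)
    define p where "p = act_bqf (sl2_inv \<delta>) p\<^sub>1"
    have pe: "bqf_equiv q\<^sub>1 p" 
      unfolding p_def by (rule bqf_equiv_act_bqf[OF p(1) sl2_inv_SL2Z[OF \<delta>(1)]])
    have p\<^sub>1: "p\<^sub>1 = act_bqf \<delta> p" using \<delta>(1) by (simp add: p_def)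
    have pc: "\<bar>real_of_int (B_Delta p q\<^sub>2)\<bar> < sqrt (of_int (disc p * disc q\<^sub>2))"
      using c unfolding p\<^sub>1 \<delta>(2) B_Delta_act_bqf[OF \<delta>(1)] disc_act_bqf[OF \<delta>(1)] .
    obtain P where "geodesic_points (root_geodesic p) \<inter> geodesic_points (root_geodesic q\<^sub>2) = {P}"
      using transverse_points_root_geodesic[OF equiv[OF pe] ind(2)] pc by auto
    hence P: "P \<in> geodesic_points (root_geodesic p)" "P \<in> geodesic_points (root_geodesic q\<^sub>2)" by auto
    obtain t where "P = path t" using P(2) unfolding path_def geodesic_points_def by (rule rangeE)
    hence t: "path t \<in> geodesic_points (root_geodesic p)" using P(1) by simp
    have L: "L > 0" unfolding L_def by (rule translation_length_pos[OF ind(2)])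
    \<comment> \<open>The multiple of L that brings t into the period starting at
      \<open>t\<^sub>0\<close>.\<close>
    define n where "n = - \<lfloor>(t - t\<^sub>0) / L\<rfloor>"
    have "of_int \<lfloor>(t - t\<^sub>0) / L\<rfloor> * L \<le> t - t\<^sub>0" "t - t\<^sub>0 < (of_int \<lfloor>(t - t\<^sub>0) / L\<rfloor> + 1) * L"
      by (rule floor_divide_lower[OF L], rule floor_divide_upper[OF L])
    hence n: "t + of_int n * L \<in> {t\<^sub>0..<t\<^sub>0 + L}" by (simp add: n_def algebra_simps)
    obtain \<epsilon> where \<epsilon>: "\<epsilon> \<in> SL2Z" "act_bqf \<epsilon> q\<^sub>2 = q\<^sub>2"
      "path (t + of_int n * L) \<in> geodesic_points (root_geodesic (act_bqf \<epsilon> p))"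
      using automorph_translates[OF ind(2) t[unfolded path_def] equiv[OF pe], of n]
      unfolding path_def L_def by blast
    have "B_Delta (act_bqf \<epsilon> p) q\<^sub>2 = B_Delta p q\<^sub>2"
      using B_Delta_act_bqf[OF \<epsilon>(1), of p q\<^sub>2] unfolding \<epsilon>(2) .
    hence "\<bar>real_of_int (B_Delta (act_bqf \<epsilon> p) q\<^sub>2)\<bar> < sqrt (of_int (disc (act_bqf \<epsilon> p) * disc q\<^sub>2))"
      using pc by (simp only: disc_act_bqf[OF \<epsilon>(1)])
    hence "act_bqf \<epsilon> p \<in> ?S" unfolding meets_segment_def mem_Collect_eq
      using bqf_equiv_act_bqf[OF pe \<epsilon>(1)] n \<epsilon>(3) unfolding path_def L_def by blast
    moreover have "X = ?h (act_bqf \<epsilon> p)"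
    proof -
      have "((act_bqf \<epsilon> p, q\<^sub>2), (p\<^sub>1, p\<^sub>2)) \<in> simultaneous_equiv"
        unfolding simultaneous_equiv_iff
      proof (intro bexI conjI)
        \<comment> \<open>The action is on the right: first undo \<epsilon>, then apply
          \<delta>.\<close>
        show "act_bqf (sl2_inv \<epsilon> ** \<delta>) (act_bqf \<epsilon> p) = p\<^sub>1"
          using \<epsilon>(1) by (simp add: act_bqf_mult p\<^sub>1)
        have "act_bqf (sl2_inv \<epsilon>) q\<^sub>2 = q\<^sub>2" using act_bqf_inv(1)[OF \<epsilon>(1), of q\<^sub>2] \<epsilon>(2) by simp
        thus "act_bqf (sl2_inv \<epsilon> ** \<delta>) q\<^sub>2 = p\<^sub>2" by (simp add: act_bqf_mult \<delta>(2))
        show "sl2_inv \<epsilon> ** \<delta> \<in> SL2Z" using \<epsilon>(1) \<delta>(1) by simp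
      qed
      thus ?thesis unfolding X using cls by blast
    qed
    ultimately show "X \<in> ?h ` ?S" by blast
  qed
qed

theorem proposition2:
  fixes q\<^sub>1 q\<^sub>2 :: bqf and D\<^sub>1 D\<^sub>2 :: int
  assumes "PIBQF q\<^sub>1" and "PIBQF q\<^sub>2" and "disc q\<^sub>1 = D\<^sub>1" and "disc q\<^sub>2 = D\<^sub>2"
  shows "finite (intersecting_pairs q\<^sub>1 q\<^sub>2 // simultaneous_equiv) \<and>
         (\<forall>z\<in>geodesic_points (root_geodesic q\<^sub>2).
            finite (lifted_intersections q\<^sub>1 q\<^sub>2 z) \<and>
            intersection_number q\<^sub>1 q\<^sub>2 z = card (intersecting_pairs q\<^sub>1 q\<^sub>2 // simultaneous_equiv)) \<and>
         (\<forall>q\<^sub>1' q\<^sub>2'. bqf_equiv q\<^sub>1 q\<^sub>1' \<longrightarrow> bqf_equiv q\<^sub>2 q\<^sub>2' \<longrightarrow>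
            (card (transverse_points (root_geodesic q\<^sub>1') (root_geodesic q\<^sub>2')) = 1 \<longleftrightarrow>
             \<bar>real_of_int (B_Delta q\<^sub>1' q\<^sub>2')\<bar> < sqrt (real_of_int (D\<^sub>1 * D\<^sub>2))))"
proof (intro conjI ballI allI impI)
  have ind: "indefinite q\<^sub>1" "indefinite q\<^sub>2" using assms PIBQF_indefinite by auto
  note fin = finite_meets_segment[OF ind]
  note quot = intersecting_pairs_bij[OF assms(1,2)]
  show "finite (intersecting_pairs q\<^sub>1 q\<^sub>2 // simultaneous_equiv)"
    using bij_betw_finite[OF quot] fin by blast
  {
    fix z assume "z \<in> geodesic_points (root_geodesic q\<^sub>2)"
    then obtain t where z: "z = geodesic_path (root_geodesic q\<^sub>2) t"
      by (auto simp: geodesic_points_def)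
    note lift = lifted_intersections_bij[OF ind, of t, folded z]
    show "finite (lifted_intersections q\<^sub>1 q\<^sub>2 z)" using bij_betw_finite[OF lift] fin by blast
    \<comment> \<open>Both bijections start from the same \<open>meets_segment\<close> with
      parameter t, and the quotient does not depend on t, so neither does the count on the base
      point.\<close>
    show "intersection_number q\<^sub>1 q\<^sub>2 z = card (intersecting_pairs q\<^sub>1 q\<^sub>2 // simultaneous_equiv)"
      unfolding intersection_number_def
      using bij_betw_same_card[OF lift] bij_betw_same_card[OF quot, of t] by simp
  next
    fix q\<^sub>1' q\<^sub>2' assume e: "bqf_equiv q\<^sub>1 q\<^sub>1'" "bqf_equiv q\<^sub>2 q\<^sub>2'"
    show "card (transverse_points (root_geodesic q\<^sub>1') (root_geodesic q\<^sub>2')) = 1 \<longleftrightarrow>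
        \<bar>real_of_int (B_Delta q\<^sub>1' q\<^sub>2')\<bar> < sqrt (real_of_int (D\<^sub>1 * D\<^sub>2))"
      using card_transverse_points_root_geodesic[OF bqf_equiv_indefinite[OF e(1) ind(1)]
          bqf_equiv_indefinite[OF e(2) ind(2)]]
      unfolding bqf_equiv_disc[OF e(1)] bqf_equiv_disc[OF e(2)] assms(3,4) .
  }
qed

end
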